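(* Assume that there are constants $\gamma\ge 0$ and $\omega'\in[0,\omega)$ such that $$M b^2 e^{\omega\tau}\int_0^t |k(s+\tau)|\,ds\le \gamma+\omega' t\qquad\text{for all } t>0 .$$ Consider the system $$U'(t)=\mathcal A U(t)-k(t)\mathcal B U(t-\tau)+F(U(t)),\quad U(0)=U_0,\quad \mathcal B U(t)=f(t)\ \text{ for } t\in[-\tau,0], \qquad (\mathrm{S})$$ with initial data $U_0\in\mathcal H$ and $f\in C([-\tau,0];\mathcal H)$. Then there exist $\rho>0$ and $C_\rho>0$, with $L(C_\rho)<\frac{\omega-\omega'}{M}$, such that if $U_0\in\mathcal H$ and $f\in C([-\tau,0];\mathcal H)$ satisfy $$\|U_0\|_{\mathcal H}^2+\int_0^\tau |k(s)|\,\|f(s-\tau)\|_{\mathcal H}^2\,ds<\rho^2,$$ then $(\mathrm{S})$ has a unique solution $U\in C([0,+\infty);\mathcal H)$ satisfying $\|U(t)\|_{\mathcal H}\le C_\rho$ for all $t>0$. Hence, for solutions of $(\mathrm{S})$ corresponding to such sufficiently small initial data, the exponential decay estimate $$\|U(t)\|_{\mathcal H}\le M e^{\gamma}\left(\|U_0\|_{\mathcal H}+\int_0^\tau e^{\omega s}|k(s)|\,\|f(s-\tau)\|_{\mathcal H}\,ds\right)e^{-(\omega-\omega'-ML(C_\rho))t}\qquad\text{for all } t\ge 0$$ holds.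
   Context: Setting. $H$ is a Hilbert space and $A:\mathcal D(A)\subset H\to H$ is a positive self-adjoint operator with dense domain and compact inverse. $W_1,W_2$ are real Hilbert spaces identified with their duals, and $C:W_1\to H$, $B:W_2\to H$ are bounded linear operators with adjoints $C^*,B^*$; $b:=\|B\|=\|B^*\|$ (operator norm). $\tau>0$ is a fixed delay. $k\in L^1_{loc}([0,+\infty))$ is real-valued, and there is $K>0$ with $\int_{t-\tau}^t|k(s)|\,ds\le K$ for all $t\ge 0$ (only the part of the interval lying in $[0,+\infty)$ is counted). Nonlinearity. $\psi:\mathcal D(A^{1/2})\to\mathbb R$ has a Gâteaux derivative $D\psi(u)$ at every $u\in\mathcal D(A^{1/2})$ and satisfies: (H1) for every $u\in\mathcal D(A^{1/2})$ there is $c(u)>0$ with $|D\psi(u)(v)|\le c(u)\|v\|_H$ for all $v\in\mathcal D(A^{1/2})$; hence $D\psi(u)$ extends to a bounded functional on $H$, and $\nabla\psi(u)\in H$ denotes its Riesz representative, $\langle\nabla\psi(u),v\rangle_H=D\psi(u)(v)$; (H2) for every $r>0$ there is $L(r)>0$ with $\|\nabla\psi(u)-\nabla\psi(v)\|_H\le L(r)\|A^{1/2}(u-v)\|_H$ whenever $\|A^{1/2}u\|_H\le r$ and $\|A^{1/2}v\|_H\le r$; (H3) $\psi(0)=0$, $\nabla\psi(0)=0$, and there is a strictly increasing continuous function $h$ on $[0,+\infty)$ with $\|\nabla\psi(u)\|_H\le h(\|A^{1/2}u\|_H)\|A^{1/2}u\|_H$ for all $u\in\mathcal D(A^{1/2})$.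 Abstract form. $\mathcal H=\mathcal D(A^{1/2})\times H$ with inner product $\langle(u,v),(\tilde u,\tilde v)\rangle_{\mathcal H}=\langle A^{1/2}u,A^{1/2}\tilde u\rangle_H+\langle v,\tilde v\rangle_H$. For $U=(u,v)$, $$\mathcal A U=(v,\,-Au-CC^*v),\qquad \mathcal B U=(0,\,BB^*v),\qquad F(U)=(0,\nabla\psi(u)).$$ It is assumed that the damping operator $CC^*$ is such that $\mathcal A$ generates an exponentially stable $C_0$-semigroup $\{S(t)\}_{t\ge0}$ on $\mathcal H$: there are $M,\omega>0$ with $\|S(t)\|_{\mathcal L(\mathcal H)}\le M e^{-\omega t}$ for all $t\ge0$. These $M,\omega$ are fixed. One has $F(0)=0$, $\|\mathcal B\|_{\mathcal L(\mathcal H)}=b^2$, and, with the same function $L(\cdot)$ as in (H2), $\|F(U)-F(V)\|_{\mathcal H}\le L(r)\|U-V\|_{\mathcal H}$ whenever $\|U\|_{\mathcal H},\|V\|_{\mathcal H}\le r$. The system is the first-order form ($U=(u,u_t)$) of $u_{tt}(t)+Au(t)+CC^*u_t(t)+k(t)BB^*u_t(t-\tau)=\nabla\psi(u(t))$. Solutions are understood in the mild sense (Duhamel's formula): $U(t)=S(t)U_0+\int_0^t S(t-s)\,[-k(s)\mathcal B U(s-\tau)+F(U(s))]\,ds$, where $\mathcal B U(s-\tau)$ means $f(s-\tau)$ for $s\in[0,\tau]$.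
   Formalization: The formal theorem additionally assumes that some r>0 satisfies L(r) < (ω−ω')/M; without this the claim fails (e.g. H=ℝ, A=C=1, k=0, ψ(u)=u², L=2), and the condition is itself implied by the stated conclusion. *)

theory Defs
  imports "HOL-Analysis.Analysis"
begin

section \<open>Unbounded operators\<close>

text \<open>An unbounded operator is a pair of a domain \<open>D\<close> and a function whose values outside \<open>D\<close>
  are irrelevant.\<close>

definition linear_map_on :: "'a::real_vector set \<Rightarrow> ('a \<Rightarrow> 'b::real_vector) \<Rightarrow> bool" where
  "linear_map_on D T \<longleftrightarrow> subspace D
     \<and> (\<forall>x\<in>D. \<forall>y\<in>D. T (x + y) = T x + T y) \<and> (\<forall>c. \<forall>x\<in>D. T (c *\<^sub>R x) = c *\<^sub>R T x)"

text \<open>The second half says that the graphs of \<open>T\<close> and of its Hilbert space adjoint agree.\<close>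

definition self_adjoint_op :: "'h::real_inner set \<Rightarrow> ('h \<Rightarrow> 'h) \<Rightarrow> bool" where
  "self_adjoint_op D T \<longleftrightarrow> linear_map_on D T \<and> closure D = UNIV
     \<and> (\<forall>y z. (y \<in> D \<and> z = T y) \<longleftrightarrow> (\<forall>x\<in>D. T x \<bullet> y = x \<bullet> z))"

text \<open>Positivity is not required to be strict here; for an invertible operator (as in the theorem)
  it then is automatically strict.\<close>

definition positive_self_adjoint :: "'h::real_inner set \<Rightarrow> ('h \<Rightarrow> 'h) \<Rightarrow> bool" where
  "positive_self_adjoint D T \<longleftrightarrow> self_adjoint_op D T \<and> (\<forall>x\<in>D. 0 \<le> T x \<bullet> x)"

definition has_compact_inverse :: "'h::real_inner set \<Rightarrow> ('h \<Rightarrow> 'h) \<Rightarrow> bool" where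
  "has_compact_inverse D T \<longleftrightarrow> bij_betw T D UNIV
     \<and> (\<forall>X. bounded X \<longrightarrow> compact (closure (inv_into D T ` X)))"

text \<open>\<open>(DR, R)\<close> is the positive square root of \<open>(D, T)\<close>; on \<open>DR\<close> it is uniquely determined by
  \<open>(D, T)\<close>, and \<open>DR\<close> is the domain of the square root.\<close>

definition positive_sqrt_op ::
  "'h::real_inner set \<Rightarrow> ('h \<Rightarrow> 'h) \<Rightarrow> 'h set \<Rightarrow> ('h \<Rightarrow> 'h) \<Rightarrow> bool" where
  "positive_sqrt_op D T DR R \<longleftrightarrow> positive_self_adjoint DR R
     \<and> D = {x \<in> DR. R x \<in> DR} \<and> (\<forall>x\<in>D. R (R x) = T x)"


section \<open>Normed spaces given by a carrier and a norm\<close>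

text \<open>The energy space carries a norm that depends on the operator and differs from the norm of the
  ambient type, so the following notions take the norm \<open>N\<close> (on the carrier \<open>V\<close>) as a parameter.\<close>

definition continuous_curve ::
  "'a::real_vector set \<Rightarrow> ('a \<Rightarrow> real) \<Rightarrow> real set \<Rightarrow> (real \<Rightarrow> 'a) \<Rightarrow> bool" where
  "continuous_curve V N I U \<longleftrightarrow> (\<forall>t\<in>I. U t \<in> V)
     \<and> (\<forall>t\<in>I. ((\<lambda>s. N (U s - U t)) \<longlongrightarrow> 0) (at t within I))"

definition C0_semigroup ::
  "'a::real_vector set \<Rightarrow> ('a \<Rightarrow> real) \<Rightarrow> (real \<Rightarrow> 'a \<Rightarrow> 'a) \<Rightarrow> bool" where
  "C0_semigroup V N S \<longleftrightarrow>
     (\<forall>t\<ge>0. linear_map_on V (S t) \<and> S t ` V \<subseteq> V \<and> (\<exists>c. \<forall>X\<in>V. N (S t X) \<le> c * N X))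
     \<and> (\<forall>X\<in>V. S 0 X = X)
     \<and> (\<forall>s\<ge>0. \<forall>t\<ge>0. \<forall>X\<in>V. S (s + t) X = S s (S t X))
     \<and> (\<forall>X\<in>V. ((\<lambda>t. N (S t X - X)) \<longlongrightarrow> 0) (at_right 0))"

definition generates_C0_semigroup ::
  "'a::real_vector set \<Rightarrow> ('a \<Rightarrow> real) \<Rightarrow> 'a set \<Rightarrow> ('a \<Rightarrow> 'a) \<Rightarrow> (real \<Rightarrow> 'a \<Rightarrow> 'a) \<Rightarrow> bool" where
  "generates_C0_semigroup V N D G S \<longleftrightarrow> C0_semigroup V N S \<and> D \<subseteq> V
     \<and> (\<forall>X\<in>V. \<forall>Y\<in>V. (X \<in> D \<and> Y = G X)
          \<longleftrightarrow> ((\<lambda>t. N ((1 / t) *\<^sub>R (S t X - X) - Y)) \<longlongrightarrow> 0) (at_right 0))"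

definition gateaux_derivative ::
  "'a::real_vector set \<Rightarrow> ('a \<Rightarrow> real) \<Rightarrow> ('a \<Rightarrow> real) \<Rightarrow> 'a \<Rightarrow> ('a \<Rightarrow> real) \<Rightarrow> bool" where
  "gateaux_derivative V N \<psi> u l \<longleftrightarrow> linear_map_on V l \<and> (\<exists>c. \<forall>v\<in>V. \<bar>l v\<bar> \<le> c * N v)
     \<and> (\<forall>v\<in>V. ((\<lambda>t. (\<psi> (u + t *\<^sub>R v) - \<psi> u) / t) \<longlongrightarrow> l v) (at 0))"

text \<open>Riesz representative in the ambient Hilbert space of a functional that is given on a dense
  subspace \<open>V\<close> and bounded there for the ambient norm.\<close>

definition riesz_representative :: "'h::real_inner set \<Rightarrow> ('h \<Rightarrow> real) \<Rightarrow> 'h" where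
  "riesz_representative V l = (THE g. \<forall>v\<in>V. g \<bullet> v = l v)"


section \<open>The energy space and the abstract evolution equation\<close>

text \<open>Throughout, \<open>(DR, R)\<close> is the square root of \<open>(DA, A)\<close>.\<close>

definition energy_space :: "'h::real_inner set \<Rightarrow> ('h \<times> 'h) set" where
  "energy_space DR = DR \<times> UNIV"

definition energy_inner :: "('h::real_inner \<Rightarrow> 'h) \<Rightarrow> 'h \<times> 'h \<Rightarrow> 'h \<times> 'h \<Rightarrow> real" where
  "energy_inner R U V = R (fst U) \<bullet> R (fst V) + snd U \<bullet> snd V"

definition energy_norm :: "('h::real_inner \<Rightarrow> 'h) \<Rightarrow> 'h \<times> 'h \<Rightarrow> real" where
  "energy_norm R U = sqrt (energy_inner R U U)"

text \<open>Integral of a curve in the energy space. The map \<open>(u, v) \<mapsto> (R u, v)\<close> is a linear isometry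
  of the energy space into the product \<open>'h \<times> 'h\<close> with its library norm, and the integral is
  transported along it. The library's gauge integral extends the Bochner integral (every Bochner
  integrable function is gauge integrable, with the same value) and needs no separability class.\<close>

definition has_energy_integral ::
  "'h::{real_inner,complete_space} set \<Rightarrow> ('h \<Rightarrow> 'h) \<Rightarrow> (real \<Rightarrow> 'h \<times> 'h) \<Rightarrow> 'h \<times> 'h \<Rightarrow> real set \<Rightarrow> bool"
where
  "has_energy_integral DR R G X I \<longleftrightarrow> (\<forall>s\<in>I. G s \<in> energy_space DR) \<and> X \<in> energy_space DR
     \<and> ((\<lambda>s. (R (fst (G s)), snd (G s))) has_integral (R (fst X), snd X)) I"

definition wave_domain :: "'h set \<Rightarrow> 'h set \<Rightarrow> ('h \<times> 'h) set" where
  "wave_domain DA DR = DA \<times> DR"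

definition wave_op ::
  "('h::real_inner \<Rightarrow> 'h) \<Rightarrow> ('w::real_inner \<Rightarrow> 'h) \<Rightarrow> 'h \<times> 'h \<Rightarrow> 'h \<times> 'h" where
  "wave_op A C U = (snd U, - A (fst U) - C (adjoint C (snd U)))"

definition delay_op :: "('w::real_inner \<Rightarrow> 'h::real_inner) \<Rightarrow> 'h \<times> 'h \<Rightarrow> 'h \<times> 'h" where
  "delay_op B U = (0, B (adjoint B (snd U)))"

definition source_op :: "('h::real_inner \<Rightarrow> 'h) \<Rightarrow> 'h \<times> 'h \<Rightarrow> 'h \<times> 'h" where
  "source_op grad U = (0, grad (fst U))"

text \<open>Mild solutions on \<open>[0, \<infinity>)\<close> of
  \<open>U' = \<A> U - k(t) \<B> U(t - \<tau>) + F(U)\<close>, \<open>U 0 = U0\<close>, \<open>\<B> U = f\<close> on \<open>[-\<tau>, 0]\<close>, where \<open>S\<close> is the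
  semigroup generated by \<open>\<A>\<close>. The history \<open>f\<close> replaces \<open>\<B> U(s - \<tau>)\<close> for \<open>s \<in> [0, \<tau>]\<close>; no
  compatibility between \<open>f 0\<close> and \<open>\<B> U0\<close> is imposed.\<close>

definition mild_solution ::
  "'h::{real_inner,complete_space} set \<Rightarrow> ('h \<Rightarrow> 'h) \<Rightarrow> (real \<Rightarrow> 'h \<times> 'h \<Rightarrow> 'h \<times> 'h)
   \<Rightarrow> (real \<Rightarrow> real) \<Rightarrow> real \<Rightarrow> ('h \<times> 'h \<Rightarrow> 'h \<times> 'h) \<Rightarrow> ('h \<times> 'h \<Rightarrow> 'h \<times> 'h)
   \<Rightarrow> 'h \<times> 'h \<Rightarrow> (real \<Rightarrow> 'h \<times> 'h) \<Rightarrow> (real \<Rightarrow> 'h \<times> 'h) \<Rightarrow> bool" where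
  "mild_solution DR R S k \<tau> BB F U0 f U \<longleftrightarrow>
     continuous_curve (energy_space DR) (energy_norm R) {0..} U
     \<and> (\<forall>t\<ge>0. has_energy_integral DR R
          (\<lambda>s. S (t - s) (- k s *\<^sub>R (if s \<le> \<tau> then f (s - \<tau>) else BB (U (s - \<tau>))) + F (U s)))
          (U t - S t U0) {0..t})"

end

theory Submission
  imports Defs
begin

text \<open>
  Writing \<open>v t = exp (\<omega> * t) * norm (U t)\<close>, Duhamel's formula and a linear bound \<open>norm (F x) \<le> l * norm x\<close>
  give an integral inequality for \<open>v\<close> in which the delayed term, shifted by \<open>\<tau>\<close>, carries the weight
  \<open>M b\<^sup>2 exp (\<omega> \<tau>) \<bar>k (s + \<tau>)\<bar>\<close>. Gronwall's inequality and the growth hypothesis on \<open>k\<close> then give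
  the decay rate \<open>\<omega> - \<omega>' - M l\<close>. The source is replaced by its composition with the radial
  retraction onto the ball of radius \<open>r\<close>, which is globally Lipschitz and obeys the linear bound with
  \<open>l = L r\<close>. The modified equation is solved globally by a contraction in an exponentially weighted
  sup norm, and for small data the decay estimate keeps its solution inside the ball, so it solves the
  original equation and no continuation argument is needed.
\<close>

section \<open>Riesz representation and adjoints\<close>

text \<open>The kernel \<open>k\<close> is only locally integrable, so its primitive is continuous
  but need not be differentiable everywhere. All integrals are reduced to those of a scalar kernel
  against a continuous curve, and the inequalities for weights are obtained by bisection from the
  continuity of the primitive.

  The energy space is a subset of a product type with a norm of its own. It is carried isometrically
  onto a Banach space type, which works because the square root of \<open>A\<close> maps its domain
  bijectively onto the whole space.

  The constants are chosen in a fixed order: a radius \<open>r\<close> with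
  \<open>L r < (\<omega> - \<omega>') / M\<close> comes first and becomes \<open>C\<rho>\<close>;
  then \<open>\<rho>\<close> is taken so small that \<open>M * exp \<gamma>\<close> times the size
  of the data stays below \<open>r\<close>. The retraction doubles the Lipschitz constant, but this
  matters only for existence: the decay rate uses the comparison with the value at zero, which keeps
  \<open>L r\<close>. Uniqueness is shown for the original source among all mild solutions, whatever
  their size, and this is what makes the decay estimate valid for every solution with small
  data.\<close>

lemma riesz_representation:
  fixes l :: "'a::{real_inner,complete_space} \<Rightarrow> real"
  assumes l: "bounded_linear l"
  shows "\<exists>g. \<forall>x. l x = x \<bullet> g"
proof -
  interpret l: bounded_linear l by (rule l)
  \<comment> \<open>Completing the square, \<open>J x\<close> is the squared distance from
    \<open>x\<close> to the vector that is sought, up to a constant. The representative is therefore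
    found as the minimiser of \<open>J\<close>.\<close>
  define J where "J x = x \<bullet> x - 2 * l x" for x
  have lower: "- (onorm l)\<^sup>2 \<le> J x" for x
  proof -
    have "l x \<le> onorm l * norm x"
      using onorm[OF l, of x] by simp
    moreover have "0 \<le> (norm x - onorm l)\<^sup>2" by simp
    ultimately show ?thesis
      unfolding J_def power2_norm_eq_inner[symmetric] by (simp add: power2_eq_square algebra_simps)
  qed
  define m where "m = Inf (range J)"
  have bdd: "bdd_below (range J)" using lower by (auto simp: bdd_below_def)
  have m_le: "m \<le> J x" for x unfolding m_def by (rule cInf_lower[OF _ bdd]) simp
  \<comment> \<open>The midpoint of \<open>x\<close> and \<open>y\<close> cannot fall below the
    infimum, so two nearly minimal points are close to each other. Hence minimising sequences are
    Cauchy.\<close>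
  have parallelogram: "(norm (x - y))\<^sup>2 \<le> 2 * (J x - m) + 2 * (J y - m)" for x y
  proof -
    have "J x + J y = 2 * J ((1/2) *\<^sub>R (x + y)) + (norm (x - y))\<^sup>2 / 2"
      unfolding J_def power2_norm_eq_inner
      by (simp add: l.add l.scaleR inner_simps inner_commute field_simps)
    then show ?thesis using m_le[of "(1/2) *\<^sub>R (x + y)"] by simp
  qed
  have "\<exists>x. J x < m + 1 / Suc i" for i
    using cInf_lessD[of "range J" "m + 1 / Suc i"] by (auto simp: m_def)
  then obtain X where X: "J (X i) < m + 1 / Suc i" for i by metis
  have "Cauchy X"
  proof (rule metric_CauchyI)
    fix e :: real assume e: "e > 0"
    then obtain N where N: "N \<noteq> 0" "inverse (real N) < e\<^sup>2 / 4"
      using real_arch_inverse[of "e\<^sup>2 / 4"] by auto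
    show "\<exists>N. \<forall>i\<ge>N. \<forall>j\<ge>N. dist (X i) (X j) < e"
    proof (intro exI allI impI)
      fix i j assume ij: "i \<ge> N" "j \<ge> N"
      have small: "J (X n) - m < e\<^sup>2 / 4" if "n \<ge> N" for n
      proof -
        have "1 / real (Suc n) \<le> inverse (real N)"
          using that N by (simp add: field_simps)
        then show ?thesis using X[of n] N by linarith
      qed
      have "(norm (X i - X j))\<^sup>2 < e\<^sup>2"
      proof -
        have "z < c" if "z \<le> 2 * p + 2 * q" "p < c / 4" "q < c / 4" for z p q c :: real
          using that by linarith
        then show ?thesis using parallelogram small[OF ij(1)] small[OF ij(2)] by blast
      qed
      then show "dist (X i) (X j) < e"
        using e by (simp add: dist_norm power2_less_imp_less)
    qed
  qed
  then obtain g where g: "X \<longlonglongrightarrow> g"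
    using Cauchy_convergent convergent_def by blast
  have "(\<lambda>i. J (X i)) \<longlonglongrightarrow> J g"
    unfolding J_def by (intro tendsto_intros l.tendsto g)
  moreover have "(\<lambda>i. m + 1 / Suc i) \<longlonglongrightarrow> m + 0"
    by (intro tendsto_intros LIMSEQ_Suc[OF lim_1_over_n])
  ultimately have Jg: "J g \<le> m"
    by (rule LIMSEQ_le[THEN order_trans]) (use X in \<open>auto intro: less_imp_le\<close>)
  have "l x = x \<bullet> g" for x
  proof -
    \<comment> \<open>First variation at the minimiser in direction \<open>x\<close>; validity for
      all \<open>t\<close>, of either sign, forces the linear coefficient to vanish.\<close>
    have ineq: "0 \<le> 2 * t * (x \<bullet> g - l x) + t\<^sup>2 * (x \<bullet> x)" for t
    proof -
      have "J g \<le> J (g + t *\<^sub>R x)" using Jg m_le order_trans by blast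
      then show ?thesis
        unfolding J_def
        by (simp add: l.add l.scaleR inner_simps inner_commute power2_eq_square algebra_simps)
    qed
    define d where "d = x \<bullet> g - l x"
    have "d = 0"
    proof (rule ccontr)
      assume "d \<noteq> 0"
      \<comment> \<open>\<open>t = - d / q\<close> is close to the minimum of the quadratic in
        \<open>t\<close>; the added 1 keeps the denominator positive when
        \<open>x = 0\<close>.\<close>
      define q where "q = x \<bullet> x + 1"
      have q: "q > 0" "x \<bullet> x < q" by (simp_all add: q_def add_nonneg_pos)
      have "0 \<le> 2 * (- d / q) * d + (- d / q)\<^sup>2 * (x \<bullet> x)"
        using ineq[of "- d / q"] by (simp add: d_def)
      also have "\<dots> \<le> 2 * (- d / q) * d + (- d / q)\<^sup>2 * q"
        using q by (intro add_left_mono mult_left_mono) auto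
      also have "\<dots> = - (d\<^sup>2 / q)"
        using q by (simp add: power2_eq_square field_simps)
      finally show False using q \<open>d \<noteq> 0\<close>
        by (metis divide_pos_pos neg_0_le_iff_le not_le zero_less_power2)
    qed
    then show ?thesis by (simp add: d_def)
  qed
  then show ?thesis by blast
qed

text \<open>\<open>adjoint\<close> is defined by choice, so its characteristic identity holds only
  once some adjoint is known to exist. Riesz representation of \<open>f x \<bullet> y\<close>, as a
  functional of \<open>x\<close>, provides one.\<close>

lemma hilbert_adjoint_works:
  fixes f :: "'a::{real_inner,complete_space} \<Rightarrow> 'b::real_inner"
  assumes f: "bounded_linear f"
  shows "f x \<bullet> y = x \<bullet> adjoint f y"
proof -
  have "\<exists>g. \<forall>x. f x \<bullet> y = x \<bullet> g" for y
    by (rule riesz_representation)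
       (rule bounded_linear_compose[OF bounded_linear_inner_left f, unfolded o_def])
  then have "\<exists>f'. \<forall>x y. f x \<bullet> y = x \<bullet> f' y" by metis
  then show ?thesis unfolding adjoint_def by (rule someI2_ex) blast
qed

lemma hilbert_adjoint_linear:
  fixes f :: "'a::{real_inner,complete_space} \<Rightarrow> 'b::real_inner"
  assumes f: "bounded_linear f"
  shows "linear (adjoint f)"
proof (rule linearI)
  note works = hilbert_adjoint_works[OF f, symmetric]
  show "adjoint f (x + y) = adjoint f x + adjoint f y" for x y
    by (subst vector_eq_ldot[symmetric]) (simp add: works inner_simps)
  show "adjoint f (c *\<^sub>R x) = c *\<^sub>R adjoint f x" for c x
    by (subst vector_eq_ldot[symmetric]) (simp add: works inner_simps)
qed

text \<open>Testing the adjoint identity with \<open>adjoint f y\<close> itself produces its squared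
  norm, and one factor cancels.\<close>

lemma norm_hilbert_adjoint_le:
  fixes f :: "'a::{real_inner,complete_space} \<Rightarrow> 'b::real_inner"
  assumes f: "bounded_linear f"
  shows "norm (adjoint f y) \<le> onorm f * norm y"
proof (cases "adjoint f y = 0")
  case True
  then show ?thesis using onorm_pos_le[OF f] by simp
next
  case False
  have "norm (adjoint f y) * norm (adjoint f y) = f (adjoint f y) \<bullet> y"
    by (simp add: hilbert_adjoint_works[OF f] flip: power2_eq_square power2_norm_eq_inner)
  also have "\<dots> \<le> norm (f (adjoint f y)) * norm y" by (rule norm_cauchy_schwarz)
  also have "\<dots> \<le> (onorm f * norm (adjoint f y)) * norm y"
    by (intro mult_right_mono onorm[OF f]) simp
  finally show ?thesis using False by simp
qed

section \<open>Integrals of a scalar kernel against a continuous curve\<close>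

text \<open>The weight \<open>\<phi>\<close> makes this the analogue of \<open>integrable_uniform_limit\<close> for kernels that
  are merely integrable.\<close>

lemma integrable_weighted_uniform_limit:
  fixes f :: "real \<Rightarrow> 'a::banach"
  assumes phi: "\<phi> integrable_on {a..b}"
    and approx: "\<And>e. e > 0 \<Longrightarrow> \<exists>g. g integrable_on {a..b} \<and> (\<forall>x\<in>{a..b}. norm (f x - g x) \<le> e * \<phi> x)"
  shows "f integrable_on {a..b}"
proof -
  define e where "e n = 1 / real (Suc n)" for n
  have e_pos: "e n > 0" for n by (simp add: e_def)
  have e_lim: "e \<longlonglongrightarrow> 0" unfolding e_def by (rule LIMSEQ_Suc[OF lim_1_over_n])
  obtain g where g: "\<And>n. g n integrable_on {a..b}"
    and fg: "\<And>n x. x \<in> {a..b} \<Longrightarrow> norm (f x - g n x) \<le> e n * \<phi> x"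
    using approx[OF e_pos] by metis
  define \<Phi> where "\<Phi> = integral {a..b} \<phi>"
  define I where "I n = integral {a..b} (g n)" for n
  \<comment> \<open>The approximation bound with \<open>e 0 = 1\<close> dominates a norm by the
    weight, so the weight is nonnegative.\<close>
  have \<Phi>: "\<Phi> \<ge> 0" unfolding \<Phi>_def
  proof (rule integral_nonneg[OF phi])
    fix x assume x: "x \<in> {a..b}"
    show "0 \<le> \<phi> x" using order_trans[OF norm_ge_zero fg[OF x, of 0]] by (simp add: e_def)
  qed
  have diff: "norm (I i - I j) \<le> (e i + e j) * \<Phi>" for i j
  proof -
    have "norm (integral {a..b} (\<lambda>x. g i x - g j x)) \<le> integral {a..b} (\<lambda>x. (e i + e j) * \<phi> x)"
    proof (rule integral_norm_bound_integral)
      show "(\<lambda>x. g i x - g j x) integrable_on {a..b}" by (intro integrable_diff g)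
      show "(\<lambda>x. (e i + e j) * \<phi> x) integrable_on {a..b}" by (intro integrable_on_mult_right phi)
      show "norm (g i x - g j x) \<le> (e i + e j) * \<phi> x" if "x \<in> {a..b}" for x
        using norm_triangle_ineq4[of "f x - g j x" "f x - g i x"] fg[OF that, of i] fg[OF that, of j]
        by (simp add: distrib_right)
    qed
    then show ?thesis by (simp add: integral_diff g I_def \<Phi>_def)
  qed
  have "Cauchy I"
  proof (rule metric_CauchyI)
    fix r :: real assume r: "r > 0"
    have "(\<lambda>n. e n * \<Phi>) \<longlonglongrightarrow> 0 * \<Phi>" by (intro tendsto_intros e_lim)
    then have "eventually (\<lambda>n. e n * \<Phi> < r / 2) sequentially"
      using r by (intro order_tendstoD(2)[of _ "0 * \<Phi>"]) auto
    then obtain N where N: "\<And>n. n \<ge> N \<Longrightarrow> e n * \<Phi> < r / 2" by (auto simp: eventually_sequentially)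
    show "\<exists>N. \<forall>i\<ge>N. \<forall>j\<ge>N. dist (I i) (I j) < r"
    proof (intro exI allI impI)
      fix i j assume "i \<ge> N" "j \<ge> N"
      then show "dist (I i) (I j) < r"
        using diff[of i j] N[of i] N[of j] by (simp add: dist_norm distrib_right)
    qed
  qed
  then obtain y where y: "I \<longlonglongrightarrow> y" using Cauchy_convergent convergent_def by blast
  have "(f has_integral y) {a..b}"
    unfolding has_integral_real
  proof (intro allI impI)
    fix r :: real assume r: "r > 0"
    have "(\<lambda>n. e n * (\<Phi> + 1)) \<longlonglongrightarrow> 0 * (\<Phi> + 1)" by (intro tendsto_intros e_lim)
    then have "eventually (\<lambda>n. e n * (\<Phi> + 1) < r / 3) sequentially"
      using r by (intro order_tendstoD(2)[of _ "0 * (\<Phi> + 1)"]) auto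
    moreover have "eventually (\<lambda>n. norm (I n - y) < r / 3) sequentially"
      using tendstoD[OF y, of "r / 3"] r by (simp add: dist_norm)
    ultimately have "eventually (\<lambda>n. e n * (\<Phi> + 1) < r / 3 \<and> norm (I n - y) < r / 3) sequentially"
      by (rule eventually_conj)
    then obtain n where n: "e n * (\<Phi> + 1) < r / 3" "norm (I n - y) < r / 3"
      by (auto simp: eventually_sequentially)
    have "(g n has_integral I n) {a..b}" unfolding I_def using g by (rule integrable_integral)
    then obtain d1 where d1: "gauge d1" "\<And>D. D tagged_division_of {a..b} \<Longrightarrow> d1 fine D \<Longrightarrow>
        norm ((\<Sum>(x,k)\<in>D. measure lborel k *\<^sub>R g n x) - I n) < r / 3"
      using r unfolding has_integral_real by (meson divide_pos_pos zero_less_numeral)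
    \<comment> \<open>A gauge for the weight alone keeps its Riemann sums below
      \<open>\<Phi> + 1\<close>. On fine divisions the sums of \<open>f\<close> and of
      \<open>g n\<close> then differ by at most \<open>e n * (\<Phi> + 1)\<close>, without
      presupposing that \<open>f\<close> is integrable.\<close>
    have "(\<phi> has_integral \<Phi>) {a..b}" unfolding \<Phi>_def using phi by (rule integrable_integral)
    then obtain d2 where d2: "gauge d2" "\<And>D. D tagged_division_of {a..b} \<Longrightarrow> d2 fine D \<Longrightarrow>
        norm ((\<Sum>(x,k)\<in>D. measure lborel k *\<^sub>R \<phi> x) - \<Phi>) < 1"
      unfolding has_integral_real by (meson zero_less_one)
    show "\<exists>\<gamma>. gauge \<gamma> \<and> (\<forall>D. D tagged_division_of {a..b} \<and> \<gamma> fine D \<longrightarrow>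
        norm ((\<Sum>(x,k)\<in>D. measure lborel k *\<^sub>R f x) - y) < r)"
    proof (intro exI[of _ "\<lambda>x. d1 x \<inter> d2 x"] conjI allI impI)
      show "gauge (\<lambda>x. d1 x \<inter> d2 x)" using d1(1) d2(1) by (rule gauge_Int)
      fix D assume "D tagged_division_of {a..b} \<and> (\<lambda>x. d1 x \<inter> d2 x) fine D"
      then have D: "D tagged_division_of {a..b}" "d1 fine D" "d2 fine D" by (auto simp: fine_Int)
      have "norm ((\<Sum>(x,k)\<in>D. measure lborel k *\<^sub>R f x) - (\<Sum>(x,k)\<in>D. measure lborel k *\<^sub>R g n x))
          = norm (\<Sum>(x,k)\<in>D. measure lborel k *\<^sub>R (f x - g n x))"
        by (simp add: sum_subtractf[symmetric] split_def scaleR_diff_right)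
      also have "\<dots> \<le> (\<Sum>(x,k)\<in>D. measure lborel k * (e n * \<phi> x))"
      proof (rule sum_norm_le, safe)
        fix x k assume "(x, k) \<in> D"
        then have "x \<in> {a..b}" using D(1) by (meson subsetD tagged_division_ofD(2,3))
        then show "norm (measure lborel k *\<^sub>R (f x - g n x)) \<le> measure lborel k * (e n * \<phi> x)"
          using fg[of x n] by (simp add: mult_left_mono)
      qed
      also have "\<dots> = e n * (\<Sum>(x,k)\<in>D. measure lborel k *\<^sub>R \<phi> x)"
        by (simp add: sum_distrib_left split_def mult.left_commute)
      also have "\<dots> \<le> e n * (\<Phi> + 1)"
        using d2(2)[OF D(1,3)] e_pos[of n] by (intro mult_left_mono) (auto simp: abs_less_iff)
      finally have "norm ((\<Sum>(x,k)\<in>D. measure lborel k *\<^sub>R f x) - (\<Sum>(x,k)\<in>D. measure lborel k *\<^sub>R g n x)) < r / 3"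
        using n(1) by linarith
      then show "norm ((\<Sum>(x,k)\<in>D. measure lborel k *\<^sub>R f x) - y) < r"
        using d1(2)[OF D(1,2)] n(2) by norm
    qed
  qed
  then show ?thesis by blast
qed

text \<open>A kernel times a constant vector is integrable, and a continuous \<open>g\<close> is
  nearly constant on short intervals. Bisection glues such pieces to a uniform approximation of
  \<open>g\<close>, and the weight \<open>\<bar>k s\<bar>\<close> turns it into the approximation
  required by the limit lemma.\<close>

lemma integrable_kernel_continuous:
  fixes g :: "real \<Rightarrow> 'a::banach"
  assumes k: "k absolutely_integrable_on {a..b}" and g: "continuous_on {a..b} g"
  shows "(\<lambda>s. k s *\<^sub>R g s) integrable_on {a..b}"
proof (cases "a \<le> b")
  case ab: True
  have k_int: "k integrable_on {a..b}" and k_abs: "(\<lambda>s. \<bar>k s\<bar>) integrable_on {a..b}"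
    using k unfolding absolutely_integrable_on_def by auto
  show ?thesis
  proof (rule integrable_weighted_uniform_limit[OF k_abs])
    fix e :: real assume e: "e > 0"
    \<comment> \<open>The guards are there because the local hypothesis of the bisection also ranges
      over intervals that stick out of \<open>{a..b}\<close>.\<close>
    define P where "P p q \<longleftrightarrow> (a \<le> p \<longrightarrow> q \<le> b \<longrightarrow>
      (\<exists>h. (\<lambda>s. k s *\<^sub>R h s) integrable_on {p..q} \<and> (\<forall>x\<in>{p..q}. norm (g x - h x) \<le> e)))" for p q
    have "P a b" using ab
    proof (rule Bolzano)
      fix p q r assume trans: "P p q" "P q r" "p \<le> q" "q \<le> r"
      show "P p r" unfolding P_def
      proof (intro impI)
        assume pr: "a \<le> p" "r \<le> b"
        then obtain h1 h2 where h: "(\<lambda>s. k s *\<^sub>R h1 s) integrable_on {p..q}" "\<forall>x\<in>{p..q}. norm (g x - h1 x) \<le> e"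
          "(\<lambda>s. k s *\<^sub>R h2 s) integrable_on {q..r}" "\<forall>x\<in>{q..r}. norm (g x - h2 x) \<le> e"
          using trans unfolding P_def by (meson order_trans)
        define h where "h x = (if x \<le> q then h1 x else h2 x)" for x
        have "(\<lambda>s. k s *\<^sub>R h s) integrable_on {p..q}"
          by (rule integrable_eq[OF h(1)]) (simp add: h_def)
        \<comment> \<open>At the seam \<open>q\<close> the glued function takes the value of
          \<open>h1\<close>, so on the right piece it agrees with \<open>h2\<close> only up to one
          point.\<close>
        moreover have "(\<lambda>s. k s *\<^sub>R h s) integrable_on {q..r}"
          by (rule integrable_spike_finite[OF _ _ h(3), where S = "{q}"]) (auto simp: h_def)
        ultimately have "(\<lambda>s. k s *\<^sub>R h s) integrable_on {p..r}"
          using trans(3,4) by (intro Henstock_Kurzweil_Integration.integrable_combine[of p q r])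
        moreover have "\<forall>x\<in>{p..r}. norm (g x - h x) \<le> e" using h(2,4) by (simp add: h_def)
        ultimately show "\<exists>h. (\<lambda>s. k s *\<^sub>R h s) integrable_on {p..r} \<and> (\<forall>x\<in>{p..r}. norm (g x - h x) \<le> e)"
          by blast
      qed
    next
      fix x assume local: "a \<le> x" "x \<le> b"
      then have "continuous (at x within {a..b}) g" using g by (simp add: continuous_on_eq_continuous_within)
      then obtain d where d: "d > 0" "\<And>y. y \<in> {a..b} \<Longrightarrow> dist y x < d \<Longrightarrow> dist (g y) (g x) < e"
        using e unfolding continuous_within_eps_delta by metis
      show "\<exists>d>0. \<forall>p q. p \<le> x \<and> x \<le> q \<and> q - p < d \<longrightarrow> P p q"
        unfolding P_def
      proof (intro exI[of _ d] conjI d(1) allI impI)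
        fix p q assume pq: "p \<le> x \<and> x \<le> q \<and> q - p < d" "a \<le> p" "q \<le> b"
        have "k integrable_on {p..q}" using pq by (intro integrable_subinterval_real[OF k_int]) auto
        then have "(\<lambda>s. k s *\<^sub>R g x) integrable_on {p..q}" by (rule integrable_on_scaleR_left)
        moreover have "\<forall>y\<in>{p..q}. norm (g y - g x) \<le> e"
        proof
          fix y assume "y \<in> {p..q}"
          then have "y \<in> {a..b}" "dist y x < d" using pq by (auto simp: dist_real_def)
          then show "norm (g y - g x) \<le> e" using d(2)[of y] by (simp add: dist_norm)
        qed
        ultimately show "\<exists>h. (\<lambda>s. k s *\<^sub>R h s) integrable_on {p..q} \<and> (\<forall>x\<in>{p..q}. norm (g x - h x) \<le> e)"
          by (intro exI[of _ "\<lambda>_. g x"] conjI)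
      qed
    qed
    then obtain h where h: "(\<lambda>s. k s *\<^sub>R h s) integrable_on {a..b}" "\<forall>x\<in>{a..b}. norm (g x - h x) \<le> e"
      unfolding P_def by blast
    show "\<exists>G. G integrable_on {a..b} \<and> (\<forall>s\<in>{a..b}. norm (k s *\<^sub>R g s - G s) \<le> e * \<bar>k s\<bar>)"
      using h by (intro exI[of _ "\<lambda>s. k s *\<^sub>R h s"])
        (auto simp: scaleR_diff_right[symmetric] mult.commute[of e] intro!: mult_left_mono)
  qed
qed auto

lemma integral_kernel_norm_bound:
  fixes g :: "real \<Rightarrow> 'a::banach"
  assumes k: "k absolutely_integrable_on {a..b}" and g: "continuous_on {a..b} g"
    and h: "continuous_on {a..b} h" "\<And>s. s \<in> {a..b} \<Longrightarrow> norm (g s) \<le> h s"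
  shows "norm (integral {a..b} (\<lambda>s. k s *\<^sub>R g s)) \<le> integral {a..b} (\<lambda>s. \<bar>k s\<bar> * h s)"
proof (rule integral_norm_bound_integral)
  show "(\<lambda>s. k s *\<^sub>R g s) integrable_on {a..b}" by (rule integrable_kernel_continuous[OF k g])
  show "(\<lambda>s. \<bar>k s\<bar> * h s) integrable_on {a..b}"
    using integrable_kernel_continuous[OF absolutely_integrable_abs[OF k] h(1)] by simp
  show "norm (k s *\<^sub>R g s) \<le> \<bar>k s\<bar> * h s" if "s \<in> {a..b}" for s
    using h(2)[OF that] by (simp add: mult_left_mono)
qed

lemma integral_nonneg_le_superinterval:
  fixes f :: "real \<Rightarrow> real"
  assumes "f integrable_on {a..d}" "a \<le> b" "c \<le> d" "\<And>x. x \<in> {a..d} \<Longrightarrow> 0 \<le> f x"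
  shows "integral {b..c} f \<le> integral {a..d} f"
  using assms by (intro integral_subset_le integrable_subinterval_real[OF assms(1)]) auto

lemma absolutely_integrable_truncate:
  fixes k :: "real \<Rightarrow> real"
  assumes k: "k absolutely_integrable_on {a..b}"
  shows "(\<lambda>s. if s \<le> c then k s else 0) absolutely_integrable_on {a..b}"
    and "(\<lambda>s. if s \<le> c then 0 else k s) absolutely_integrable_on {a..b}"
proof -
  have "k absolutely_integrable_on ({..c} \<inter> {a..b})"
    by (rule set_integrable_subset[OF k]) auto
  then have "k integrable_on ({..c} \<inter> {a..b})" "(\<lambda>s. \<bar>k s\<bar>) integrable_on ({..c} \<inter> {a..b})"
    by (simp_all add: absolutely_integrable_on_def)
  then have *: "(\<lambda>s. if s \<in> {..c} then k s else 0) integrable_on {a..b}"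
    "(\<lambda>s. if s \<in> {..c} then \<bar>k s\<bar> else 0) integrable_on {a..b}"
    by (simp_all only: integrable_restrict_Int)
  show 1: "(\<lambda>s. if s \<le> c then k s else 0) absolutely_integrable_on {a..b}"
    unfolding absolutely_integrable_on_def
    using * by (simp add: if_distrib[of abs] cong: if_cong)
  have "(\<lambda>s. k s - (if s \<le> c then k s else 0)) absolutely_integrable_on {a..b}"
    using k 1 by (rule set_integral_diff)
  moreover have "(\<lambda>s. k s - (if s \<le> c then k s else 0)) = (\<lambda>s. if s \<le> c then 0 else k s)"
    by auto
  ultimately show "(\<lambda>s. if s \<le> c then 0 else k s) absolutely_integrable_on {a..b}" by simp
qed

section \<open>Gronwall inequalities for integrable weights\<close>

lemma integral_split_diff:
  fixes f :: "real \<Rightarrow> real"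
  assumes "f integrable_on {a..t}" "a \<le> s" "s \<le> t"
  shows "integral {a..t} f - integral {a..s} f = integral {s..t} f"
  using Henstock_Kurzweil_Integration.integral_combine[OF assms(2,3,1)] by simp

text \<open>Supplies the local hypothesis of the bisections below: an integrable weight may be
  unbounded, but its primitive is continuous, so short intervals around a point carry little
  mass.\<close>

lemma primitive_local_smallness:
  fixes a :: "real \<Rightarrow> real"
  assumes a: "a integrable_on {0..T}" and x: "0 \<le> x" "x \<le> T" and e: "e > 0"
  shows "\<exists>d>0. \<forall>s t. 0 \<le> s \<and> s \<le> x \<and> x \<le> t \<and> t \<le> T \<and> t - s < d \<longrightarrow>
    integral {0..t} a - integral {0..s} a < e"
proof -
  have "continuous_on {0..T} (\<lambda>t. integral {0..t} a)" using a by (rule indefinite_integral_continuous_1)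
  then have "continuous (at x within {0..T}) (\<lambda>t. integral {0..t} a)"
    using x by (simp add: continuous_on_eq_continuous_within)
  then obtain d where d: "d > 0"
    "\<And>y. y \<in> {0..T} \<Longrightarrow> dist y x < d \<Longrightarrow> dist (integral {0..y} a) (integral {0..x} a) < e / 2"
    using e unfolding continuous_within_eps_delta by (metis half_gt_zero)
  show ?thesis
  proof (intro exI[of _ d] conjI d(1) allI impI)
    fix s t assume st: "0 \<le> s \<and> s \<le> x \<and> x \<le> t \<and> t \<le> T \<and> t - s < d"
    then have "dist (integral {0..s} a) (integral {0..x} a) < e / 2"
      "dist (integral {0..t} a) (integral {0..x} a) < e / 2"
      by (intro d(2); simp add: dist_real_def)+
    then show "integral {0..t} a - integral {0..s} a < e"
      unfolding dist_real_def by linarith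
  qed
qed

text \<open>Differentiating the weight is avoided: both inequalities below are additive over adjacent
  intervals, so by bisection it suffices to check them on short intervals.\<close>

lemma gronwall_integrable_weight:
  fixes a u :: "real \<Rightarrow> real"
  assumes T: "T \<ge> 0" and c: "c \<ge> 0"
    and a: "a integrable_on {0..T}" "\<And>s. s \<in> {0..T} \<Longrightarrow> a s \<ge> 0"
    and u: "continuous_on {0..T} u" "\<And>s. s \<in> {0..T} \<Longrightarrow> u s \<ge> 0"
    and le: "\<And>t. t \<in> {0..T} \<Longrightarrow> u t \<le> c + integral {0..t} (\<lambda>s. a s * u s)"
  shows "u T \<le> c * exp (integral {0..T} a)"
proof -
  define m where "m t = integral {0..t} a" for t
  \<comment> \<open>Unlike \<open>u\<close>, the majorant \<open>v\<close> is monotone, so on an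
    interval it can be replaced by its value at the right end.\<close>
  define v where "v t = c + integral {0..t} (\<lambda>s. a s * u s)" for t
  have a_abs: "a absolutely_integrable_on {0..T}"
    using a by (intro nonnegative_absolutely_integrable_1) auto
  have au: "(\<lambda>s. a s * u s) integrable_on {0..T}"
    using integrable_kernel_continuous[OF a_abs u(1)] by simp
  have au_nonneg: "a s * u s \<ge> 0" if "s \<in> {0..T}" for s using a(2)[OF that] u(2)[OF that] by simp
  have v_mono: "v s \<le> v t" if "0 \<le> s" "s \<le> t" "t \<le> T" for s t
    unfolding v_def using that au_nonneg
    by (intro add_left_mono integral_nonneg_le_superinterval integrable_subinterval_real[OF au]) auto
  have v_nonneg: "v t \<ge> 0" if "0 \<le> t" "t \<le> T" for t
    using v_mono[of 0 t] that c by (simp add: v_def)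
  have m_mono: "m s \<le> m t" if "0 \<le> s" "s \<le> t" "t \<le> T" for s t
    unfolding m_def using that a(2)
    by (intro integral_nonneg_le_superinterval integrable_subinterval_real[OF a(1)]) auto
  have step: "v t - v s \<le> v t * (m t - m s)" if st: "0 \<le> s" "s \<le> t" "t \<le> T" for s t
  proof -
    have ints: "a integrable_on {0..t}" "(\<lambda>s. a s * u s) integrable_on {0..t}"
      "a integrable_on {s..t}" "(\<lambda>s. a s * u s) integrable_on {s..t}"
      using st by (auto intro!: integrable_subinterval_real[OF a(1)] integrable_subinterval_real[OF au])
    have "v t - v s = integral {s..t} (\<lambda>x. a x * u x)"
      unfolding v_def using integral_split_diff[OF ints(2) st(1,2)] by simp
    also have "\<dots> \<le> integral {s..t} (\<lambda>x. v t * a x)"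
    proof (rule integral_le)
      fix x assume x: "x \<in> {s..t}"
      then have "u x \<le> v t" using le[of x] v_mono[of x t] st by (auto simp: v_def)
      then show "a x * u x \<le> v t * a x"
        using a(2)[of x] x st by (simp add: mult.commute[of "v t"] mult_left_mono)
    qed (use ints in \<open>auto intro: integrable_on_mult_right\<close>)
    also have "\<dots> = v t * (m t - m s)"
      unfolding m_def using integral_split_diff[OF ints(1) st(1,2)] by simp
    finally show ?thesis .
  qed
  \<comment> \<open>The increment bound yields only \<open>v t * (1 - y) \<le> v s\<close>, with
    \<open>y\<close> the mass of the weight, and for \<open>y > 0\<close> the factor
    \<open>1 / (1 - y)\<close> exceeds \<open>exp y\<close>. On short intervals the factor
    \<open>1 + e\<close> absorbs the loss; it is removed at the end by letting \<open>e\<close> tend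
    to 0.\<close>
  have bound: "v T \<le> v 0 * exp ((1 + e) * m T)" if e: "e > 0" for e
  proof -
    define P where "P s t \<longleftrightarrow> (0 \<le> s \<longrightarrow> t \<le> T \<longrightarrow> v t \<le> v s * exp ((1 + e) * (m t - m s)))" for s t
    have "P 0 T" using T
    proof (rule Bolzano)
      fix p q r assume "P p q" "P q r" and pqr: "p \<le> q" "q \<le> r"
      show "P p r" unfolding P_def
      proof (intro impI)
        assume pr: "0 \<le> p" "r \<le> T"
        have 1: "v q \<le> v p * exp ((1 + e) * (m q - m p))" and 2: "v r \<le> v q * exp ((1 + e) * (m r - m q))"
          using \<open>P p q\<close> \<open>P q r\<close> pqr pr unfolding P_def by auto
        have "v r \<le> v p * exp ((1 + e) * (m q - m p)) * exp ((1 + e) * (m r - m q))"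
          by (rule order_trans[OF 2 mult_right_mono[OF 1]]) simp
        also have "\<dots> = v p * exp ((1 + e) * (m r - m p))"
          by (simp add: mult.assoc exp_add[symmetric] algebra_simps)
        finally show "v r \<le> v p * exp ((1 + e) * (m r - m p))" .
      qed
    next
      fix x assume x: "0 \<le> x" "x \<le> T"
      \<comment> \<open>Up to this threshold \<open>1 / (1 - y) \<le> 1 + (1 + e) * y\<close> holds,
        and the right side is at most \<open>exp ((1 + e) * y)\<close>.\<close>
      have pos: "e / (1 + e) > 0" using e by simp
      obtain d where d: "d > 0" "\<And>s t. 0 \<le> s \<Longrightarrow> s \<le> x \<Longrightarrow> x \<le> t \<Longrightarrow> t \<le> T \<Longrightarrow> t - s < d \<Longrightarrow>
          m t - m s < e / (1 + e)"
        using primitive_local_smallness[OF a(1) x pos] unfolding m_def by blast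
      show "\<exists>d>0. \<forall>s t. s \<le> x \<and> x \<le> t \<and> t - s < d \<longrightarrow> P s t"
        unfolding P_def
      proof (intro exI[of _ d] conjI d(1) allI impI)
        fix s t assume st: "s \<le> x \<and> x \<le> t \<and> t - s < d" "0 \<le> s" "t \<le> T"
        define y where "y = m t - m s"
        have y: "0 \<le> y" "y < e / (1 + e)" using d(2)[of s t] m_mono[of s t] st by (auto simp: y_def)
        have y1: "y < 1" using y(2) e by (smt (verit) divide_less_eq_1_pos)
        have "(1 + e) * y < e" using y(2) e by (simp add: pos_less_divide_eq mult.commute)
        then have "y \<le> (1 + e) * y * (1 - y)"
          using mult_left_mono[of "(1 + e) * y" e y] y(1) by (simp add: algebra_simps)
        then have "y / (1 - y) \<le> (1 + e) * y" using y1 by (simp add: pos_divide_le_eq)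
        then have "1 + y / (1 - y) \<le> exp ((1 + e) * y)"
          using exp_ge_add_one_self[of "(1 + e) * y"] by linarith
        then have *: "1 \<le> exp ((1 + e) * y) * (1 - y)" using y1 by (simp add: field_simps)
        have "v t * 1 \<le> v t * (exp ((1 + e) * y) * (1 - y))"
          using v_nonneg[of t] st by (intro mult_left_mono *) auto
        also have "\<dots> = (v t * (1 - y)) * exp ((1 + e) * y)" by simp
        also have "\<dots> \<le> v s * exp ((1 + e) * y)"
          using step[of s t] st by (intro mult_right_mono) (simp_all add: y_def algebra_simps)
        finally show "v t \<le> v s * exp ((1 + e) * (m t - m s))" by (simp add: y_def)
      qed
    qed
    then show ?thesis using T by (simp add: P_def m_def)
  qed
  have "((\<lambda>e. v 0 * exp ((1 + e) * m T)) \<longlongrightarrow> v 0 * exp ((1 + 0) * m T)) (at_right 0)"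
    by (intro tendsto_intros)
  moreover have "eventually (\<lambda>e. v T \<le> v 0 * exp ((1 + e) * m T)) (at_right 0)"
    using bound by (auto simp: eventually_at_right_field intro: exI[of _ 1])
  ultimately have "v T \<le> v 0 * exp ((1 + 0) * m T)"
    by (intro tendsto_lowerbound) auto
  then show ?thesis using le[of T] T by (simp add: v_def m_def)
qed

text \<open>The exact value is a quarter of the exponential minus one. One half is all that the
  contraction needs, and the slack of a factor 2 lets the bisection treat the exponential as
  constant on short intervals.\<close>

lemma integral_weight_exp_primitive:
  fixes a :: "real \<Rightarrow> real"
  assumes T: "T \<ge> 0"
    and a: "a integrable_on {0..T}" "\<And>s. s \<in> {0..T} \<Longrightarrow> a s \<ge> 0"
  shows "integral {0..T} (\<lambda>s. a s * exp (4 * integral {0..s} a)) \<le> exp (4 * integral {0..T} a) / 2"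
proof -
  define m where "m t = integral {0..t} a" for t
  have a_abs: "a absolutely_integrable_on {0..T}"
    using a by (intro nonnegative_absolutely_integrable_1) auto
  have m_cont: "continuous_on {0..T} m" unfolding m_def using a(1) by (rule indefinite_integral_continuous_1)
  have am: "(\<lambda>s. a s * exp (4 * m s)) integrable_on {0..T}"
    using integrable_kernel_continuous[OF a_abs, of "\<lambda>s. exp (4 * m s)"] m_cont
    by (simp add: continuous_intros)
  have m_mono: "m s \<le> m t" if "0 \<le> s" "s \<le> t" "t \<le> T" for s t
    unfolding m_def using that a(2)
    by (intro integral_nonneg_le_superinterval integrable_subinterval_real[OF a(1)]) auto
  define P where "P s t \<longleftrightarrow> (0 \<le> s \<longrightarrow> t \<le> T \<longrightarrow>
    integral {s..t} (\<lambda>s. a s * exp (4 * m s)) \<le> (exp (4 * m t) - exp (4 * m s)) / 2)" for s t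
  have "P 0 T" using T
  proof (rule Bolzano)
    fix p q r assume "P p q" "P q r" and pqr: "p \<le> q" "q \<le> r"
    then show "P p r" unfolding P_def
      using Henstock_Kurzweil_Integration.integral_combine[OF pqr integrable_subinterval_real[OF am]] by (fastforce simp: field_simps)
  next
    fix x assume x: "0 \<le> x" "x \<le> T"
    \<comment> \<open>With mass below \<open>ln 2 / 4\<close> the exponential grows at most by the
      factor 2 across the interval, which is the available slack.\<close>
    have pos: "ln 2 / 4 > (0::real)" by simp
    obtain d where d: "d > 0" "\<And>s t. 0 \<le> s \<Longrightarrow> s \<le> x \<Longrightarrow> x \<le> t \<Longrightarrow> t \<le> T \<Longrightarrow> t - s < d \<Longrightarrow>
        m t - m s < ln 2 / 4"
      using primitive_local_smallness[OF a(1) x pos] unfolding m_def by blast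
    show "\<exists>d>0. \<forall>s t. s \<le> x \<and> x \<le> t \<and> t - s < d \<longrightarrow> P s t"
      unfolding P_def
    proof (intro exI[of _ d] conjI d(1) allI impI)
      fix s t assume st: "s \<le> x \<and> x \<le> t \<and> t - s < d" "0 \<le> s" "t \<le> T"
      define y where "y = m t - m s"
      have y: "0 \<le> y" "y < ln 2 / 4" using d(2)[of s t] m_mono[of s t] st by (auto simp: y_def)
      have ints: "a integrable_on {0..t}" "a integrable_on {s..t}" "(\<lambda>s. a s * exp (4 * m s)) integrable_on {s..t}"
        using st by (auto intro!: integrable_subinterval_real[OF a(1)] integrable_subinterval_real[OF am])
      have "exp (4 * y) \<le> exp (ln 2)" using y by (simp only: exp_le_cancel_iff)
      then have e2: "exp (4 * y) \<le> 2" by simp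
      have mt: "exp (4 * m t) = exp (4 * m s) * exp (4 * y)"
        unfolding y_def by (simp add: exp_add[symmetric] algebra_simps)
      have "integral {s..t} (\<lambda>x. a x * exp (4 * m x)) \<le> integral {s..t} (\<lambda>x. exp (4 * m t) * a x)"
      proof (rule integral_le)
        fix x assume x: "x \<in> {s..t}"
        then show "a x * exp (4 * m x) \<le> exp (4 * m t) * a x"
          using a(2)[of x] m_mono[of x t] st by (simp add: mult.commute[of _ "a x"] mult_left_mono)
      qed (use ints in \<open>auto intro: integrable_on_mult_right\<close>)
      also have "\<dots> = exp (4 * m t) * y"
        unfolding m_def y_def using integral_split_diff[OF ints(1) st(2)] st by simp
      also have "\<dots> \<le> exp (4 * m s) * (2 * y)"
        unfolding mt using mult_right_mono[OF e2 y(1)] by simp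
      also have "\<dots> \<le> exp (4 * m s) * ((exp (4 * y) - 1) / 2)"
      proof (rule mult_left_mono)
        have "1 + 4 * y \<le> E \<Longrightarrow> 2 * y \<le> (E - 1) / 2" for E :: real by simp
        then show "2 * y \<le> (exp (4 * y) - 1) / 2" using exp_ge_add_one_self by blast
      qed simp
      also have "\<dots> = (exp (4 * m t) - exp (4 * m s)) / 2"
        unfolding mt by (simp add: algebra_simps diff_divide_distrib)
      finally show "integral {s..t} (\<lambda>s. a s * exp (4 * m s)) \<le> (exp (4 * m t) - exp (4 * m s)) / 2" .
    qed
  qed
  then show ?thesis using T unfolding P_def m_def by simp
qed

text \<open>Shifting time by \<open>\<tau>\<close> moves the delay from \<open>u\<close> onto the
  weight and leaves the ordinary inequality with weight \<open>\<kappa> (s + \<tau>) + l\<close>.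
  The clamp \<open>max 0\<close> keeps the argument of \<open>u\<close> nonnegative and acts only
  where the truncated kernel vanishes.\<close>

lemma gronwall_delay:
  fixes \<kappa> u :: "real \<Rightarrow> real"
  assumes \<tau>: "\<tau> > 0" and T: "T \<ge> 0" and c: "c \<ge> 0" and l: "l \<ge> 0"
    and \<kappa>: "\<And>T. \<kappa> integrable_on {0..T}" "\<And>s. s \<ge> 0 \<Longrightarrow> \<kappa> s \<ge> 0"
    and u: "continuous_on {0..T} u" "\<And>s. s \<in> {0..T} \<Longrightarrow> u s \<ge> 0"
    and le: "\<And>t. t \<in> {0..T} \<Longrightarrow> u t \<le> c
      + integral {0..t} (\<lambda>s. (if s \<le> \<tau> then 0 else \<kappa> s) * u (max 0 (s - \<tau>))) + l * integral {0..t} u"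
  shows "u T \<le> c * exp (integral {0..T} (\<lambda>s. \<kappa> (s + \<tau>)) + l * T)"
proof -
  have \<kappa>_abs: "\<kappa> absolutely_integrable_on {0..t}" for t
    using \<kappa> by (intro nonnegative_absolutely_integrable_1) auto
  have shift: "(\<lambda>s. \<kappa> (s + \<tau>)) integrable_on {0..t}" if "t \<ge> 0" for t
    using integrable_shift_real_ivl[OF integrable_subinterval_real[OF \<kappa>(1)[of "t + \<tau>"], of \<tau> "t + \<tau>"], of \<tau>] \<tau>
    by simp
  have shift_abs: "(\<lambda>s. \<kappa> (s + \<tau>)) absolutely_integrable_on {0..t}" if "t \<ge> 0" for t
    using shift[OF that] \<kappa>(2) \<tau> by (intro nonnegative_absolutely_integrable_1) auto
  have u_sub: "continuous_on {0..t} u" if "t \<le> T" for t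
    using that by (intro continuous_on_subset[OF u(1)]) auto
  have "u T \<le> c * exp (integral {0..T} (\<lambda>s. \<kappa> (s + \<tau>) + l))"
  proof (rule gronwall_integrable_weight[OF T c _ _ u])
    show "(\<lambda>s. \<kappa> (s + \<tau>) + l) integrable_on {0..T}"
      by (intro integrable_add shift T) auto
    show "\<kappa> (s + \<tau>) + l \<ge> 0" if "s \<in> {0..T}" for s using \<kappa>(2)[of "s + \<tau>"] \<tau> l that by auto
    fix t assume t: "t \<in> {0..T}"
    define \<phi> where "\<phi> s = (if s \<le> \<tau> then 0 else \<kappa> s) * u (max 0 (s - \<tau>))" for s
    have "continuous_on {0..t + \<tau>} (\<lambda>s. u (max 0 (s - \<tau>)))"
      by (rule continuous_on_compose2[OF u(1)]) (use t in \<open>auto intro!: continuous_intros\<close>)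
    then have \<phi>_int: "\<phi> integrable_on {0..t + \<tau>}"
      using integrable_kernel_continuous[OF absolutely_integrable_truncate(2)[OF \<kappa>_abs, of "t + \<tau>" \<tau>],
          of "\<lambda>s. u (max 0 (s - \<tau>))"]
      unfolding \<phi>_def by simp
    have ku: "(\<lambda>s. \<kappa> (s + \<tau>) * u s) integrable_on {0..t}"
      using integrable_kernel_continuous[OF shift_abs u_sub] t by auto
    \<comment> \<open>The integrand is nonnegative, so the upper limit may be raised to
      \<open>t + \<tau>\<close>; after the shift the integral then ends at \<open>t\<close>.\<close>
    have "integral {0..t} \<phi> \<le> integral {0..t + \<tau>} \<phi>"
    proof (rule integral_nonneg_le_superinterval[OF \<phi>_int])
      fix x assume "x \<in> {0..t + \<tau>}"
      then show "0 \<le> \<phi> x" using \<kappa>(2)[of x] u(2)[of "max 0 (x - \<tau>)"] t unfolding \<phi>_def by auto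
    qed (use \<tau> in auto)
    also have "\<dots> = integral {- \<tau>..t} (\<lambda>s. \<phi> (s + \<tau>))"
      using integral_shift_real_ivl[of 0 \<tau> "t + \<tau>" \<phi>] by simp
    also have "\<dots> = integral {- \<tau>..0} (\<lambda>s. \<phi> (s + \<tau>)) + integral {0..t} (\<lambda>s. \<phi> (s + \<tau>))"
      using integrable_shift_real_ivl[OF \<phi>_int, of \<tau>] t \<tau> by (intro Henstock_Kurzweil_Integration.integral_combine[symmetric]) auto
    also have "integral {- \<tau>..0} (\<lambda>s. \<phi> (s + \<tau>)) = integral {- \<tau>..0} (\<lambda>s. 0)"
      by (rule integral_cong) (simp add: \<phi>_def)
    \<comment> \<open>The integrands can differ only at \<open>s = 0\<close>, which the shift sends
      to \<open>\<tau>\<close>, where the truncation gives 0.\<close>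
    also have "integral {0..t} (\<lambda>s. \<phi> (s + \<tau>)) = integral {0..t} (\<lambda>s. \<kappa> (s + \<tau>) * u s)"
      by (rule integral_spike[of "{0}"]) (auto simp: \<phi>_def)
    finally have le1: "integral {0..t} \<phi> \<le> integral {0..t} (\<lambda>s. \<kappa> (s + \<tau>) * u s)" by simp
    have u_int: "u integrable_on {0..t}" using t by (intro integrable_continuous_interval u_sub) auto
    have "integral {0..t} (\<lambda>s. (\<kappa> (s + \<tau>) + l) * u s)
        = integral {0..t} (\<lambda>s. \<kappa> (s + \<tau>) * u s) + l * integral {0..t} u"
      using integral_add[OF ku integrable_on_mult_right[OF u_int, of l]] by (simp add: distrib_right)
    then show "u t \<le> c + integral {0..t} (\<lambda>s. (\<kappa> (s + \<tau>) + l) * u s)"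
      using le[OF t] le1 unfolding \<phi>_def by linarith
  qed
  also have "integral {0..T} (\<lambda>s. \<kappa> (s + \<tau>) + l) = integral {0..T} (\<lambda>s. \<kappa> (s + \<tau>)) + l * T"
    using integral_add[OF shift[OF T] integrable_const_ivl[of l 0 T]] T by (simp add: mult.commute)
  finally show ?thesis .
qed

section \<open>Mild solutions of a semilinear delay equation\<close>

text \<open>The variable \<open>t\<close> enters both the integrand and the upper limit. Uniform
  continuity of \<open>q\<close> on the compact square handles the first, continuity of the
  primitive of \<open>\<bar>k\<bar>\<close> the second. The curve family must be continuous on the
  whole square, also where \<open>s > t\<close>.\<close>

lemma continuous_on_volterra:
  fixes q :: "real \<Rightarrow> real \<Rightarrow> 'a::banach"
  assumes q: "continuous_on ({0..N} \<times> {0..N}) (\<lambda>(t, s). q t s)"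
    and k: "k absolutely_integrable_on {0..N}"
  shows "continuous_on {0..N} (\<lambda>t. integral {0..t} (\<lambda>s. k s *\<^sub>R q t s))"
proof -
  define Y where "Y t = integral {0..t} (\<lambda>s. k s *\<^sub>R q t s)" for t
  define m where "m t = integral {0..t} (\<lambda>s. \<bar>k s\<bar>)" for t
  have k_abs: "(\<lambda>s. \<bar>k s\<bar>) integrable_on {0..N}"
    using k unfolding absolutely_integrable_on_def by auto
  have comp: "compact ({0..N} \<times> {0..N})" by (intro compact_Times compact_Icc)
  have qt: "continuous_on {0..N} (q t)" if "t \<in> {0..N}" for t
    using continuous_on_compose2[OF q, of "{0..N}" "\<lambda>s. (t, s)"] that
    by (force intro: continuous_on_Pair continuous_on_const continuous_on_id)
  have "bounded ((\<lambda>(t, s). q t s) ` ({0..N} \<times> {0..N}))"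
    using compact_continuous_image[OF q comp] by (rule compact_imp_bounded)
  then obtain Q where Q: "Q > 0" "\<And>t s. t \<in> {0..N} \<Longrightarrow> s \<in> {0..N} \<Longrightarrow> norm (q t s) \<le> Q"
    by (auto simp: bounded_pos)
  have m_nonneg: "m t \<ge> 0" if "t \<le> N" for t
    unfolding m_def using that
    by (intro integral_nonneg integrable_subinterval_real[OF k_abs]) auto
  have m_N: "m t \<le> m N" if "t \<in> {0..N}" for t
    unfolding m_def using that by (intro integral_nonneg_le_superinterval[OF k_abs]) auto
  have step: "norm (Y t - Y s) \<le> e * m N + Q * (m t - m s)"
    if st: "0 \<le> s" "s \<le> t" "t \<le> N" and e: "\<And>x. x \<in> {0..N} \<Longrightarrow> norm (q t x - q s x) \<le> e" "e \<ge> 0" for s t e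
  proof -
    have ks: "k absolutely_integrable_on {0..s}" and kst: "k absolutely_integrable_on {s..t}"
      and kt: "k absolutely_integrable_on {0..t}"
      using st by (auto intro: absolutely_integrable_on_subinterval[OF k])
    have cs: "continuous_on {0..s} (q s)" "continuous_on {0..s} (q t)" "continuous_on {s..t} (q t)"
       "continuous_on {0..t} (q t)"
      using st by (auto intro!: continuous_on_subset[OF qt])
    note int = integrable_kernel_continuous
    have "Y t = integral {0..s} (\<lambda>x. k x *\<^sub>R q t x) + integral {s..t} (\<lambda>x. k x *\<^sub>R q t x)"
      unfolding Y_def using Henstock_Kurzweil_Integration.integral_combine[OF st(1,2) int[OF kt cs(4)]] by simp
    then have "Y t - Y s = integral {0..s} (\<lambda>x. k x *\<^sub>R (q t x - q s x)) + integral {s..t} (\<lambda>x. k x *\<^sub>R q t x)"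
      unfolding Y_def using integral_diff[OF int[OF ks cs(2)] int[OF ks cs(1)]]
      by (simp add: scaleR_diff_right)
    also have "norm \<dots> \<le> integral {0..s} (\<lambda>x. \<bar>k x\<bar> * e) + integral {s..t} (\<lambda>x. \<bar>k x\<bar> * Q)"
    proof (rule norm_triangle_mono; rule integral_kernel_norm_bound)
      show "norm (q t x - q s x) \<le> e" if "x \<in> {0..s}" for x using e that st by auto
      show "norm (q t x) \<le> Q" if "x \<in> {s..t}" for x using Q that st by auto
    qed (use ks kst cs in \<open>auto intro!: continuous_intros\<close>)
    also have "integral {0..s} (\<lambda>x. \<bar>k x\<bar> * e) = m s * e" by (simp add: m_def)
    also have "integral {s..t} (\<lambda>x. \<bar>k x\<bar> * Q) = (m t - m s) * Q"
      unfolding m_def using integral_split_diff[OF integrable_subinterval_real[OF k_abs] st(1,2)] st by simp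
    also have "m s * e + (m t - m s) * Q \<le> e * m N + Q * (m t - m s)"
      using m_N[of s] e(2) st by (simp add: mult.commute mult_left_mono)
    finally show ?thesis .
  qed
  have "\<exists>d>0. \<forall>s t. 0 \<le> s \<and> s \<le> t \<and> t \<le> N \<and> t - s < d \<longrightarrow> norm (Y t - Y s) < e" if e: "e > 0" for e
  proof -
    \<comment> \<open>\<open>e1\<close> is for the change of the integrand against the total mass
      \<open>m N\<close>, \<open>e2\<close> for the mass of the added strip against the bound
      \<open>Q\<close>; each may use half of \<open>e\<close>. The added 1 covers a vanishing
      kernel.\<close>
    define e1 where "e1 = e / (2 * (m N + 1))"
    define e2 where "e2 = e / (2 * Q)"
    have pos: "e1 > 0" "e2 > 0" using e Q m_nonneg[of N] by (auto simp: e1_def e2_def)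
    have "uniformly_continuous_on ({0..N} \<times> {0..N}) (\<lambda>(t, s). q t s)"
      using q comp by (rule compact_uniformly_continuous)
    then obtain d1 where d1: "d1 > 0" "\<And>p p'. p \<in> {0..N} \<times> {0..N} \<Longrightarrow> p' \<in> {0..N} \<times> {0..N} \<Longrightarrow>
        dist p' p < d1 \<Longrightarrow> dist ((\<lambda>(t, s). q t s) p') ((\<lambda>(t, s). q t s) p) < e1"
      using pos(1) unfolding uniformly_continuous_on_def by metis
    have "uniformly_continuous_on {0..N} m"
      unfolding m_def using indefinite_integral_continuous_1[OF k_abs] compact_Icc by (rule compact_uniformly_continuous)
    then obtain d2 where d2: "d2 > 0" "\<And>t s. s \<in> {0..N} \<Longrightarrow> t \<in> {0..N} \<Longrightarrow> dist t s < d2 \<Longrightarrow> dist (m t) (m s) < e2"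
      using pos(2) unfolding uniformly_continuous_on_def by metis
    show ?thesis
    proof (intro exI[of _ "min d1 d2"] conjI allI impI)
      show "min d1 d2 > 0" using d1 d2 by simp
      fix s t assume st: "0 \<le> s \<and> s \<le> t \<and> t \<le> N \<and> t - s < min d1 d2"
      have "norm (q t x - q s x) \<le> e1" if "x \<in> {0..N}" for x
        using d1(2)[of "(s, x)" "(t, x)"] that st by (simp add: dist_Pair_Pair dist_real_def dist_norm)
      then have "norm (Y t - Y s) \<le> e1 * m N + Q * (m t - m s)" using st pos(1) by (intro step) auto
      also have "\<dots> < e / 2 + e / 2"
      proof (rule add_le_less_mono)
        have "e1 * m N \<le> e1 * (m N + 1)" using pos(1) by simp
        then show "e1 * m N \<le> e / 2" using m_nonneg[of N] e by (simp add: e1_def field_simps)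
        have "m t - m s < e2" using d2(2)[of s t] st by (auto simp: dist_real_def abs_less_iff)
        then have "Q * (m t - m s) < Q * e2" using Q(1) by (intro mult_strict_left_mono)
        then show "Q * (m t - m s) < e / 2" using Q(1) by (simp add: e2_def)
      qed
      finally show "norm (Y t - Y s) < e" by simp
    qed
  qed
  note main = this
  have "continuous_on {0..N} Y"
    unfolding continuous_on_iff
  proof (intro ballI allI impI)
    fix t e :: real assume t: "t \<in> {0..N}" and e: "e > 0"
    obtain d where d: "d > 0" "\<And>s t. 0 \<le> s \<Longrightarrow> s \<le> t \<Longrightarrow> t \<le> N \<Longrightarrow> t - s < d \<Longrightarrow> norm (Y t - Y s) < e"
      using main[OF e] by blast
    show "\<exists>d>0. \<forall>s\<in>{0..N}. dist s t < d \<longrightarrow> dist (Y s) (Y t) < e"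
    proof (intro exI[of _ d] conjI d(1) ballI impI)
      fix s assume s: "s \<in> {0..N}" "dist s t < d"
      show "dist (Y s) (Y t) < e"
      proof (cases "s \<le> t")
        case True
        then show ?thesis using d(2)[of s t] s t by (simp add: dist_norm norm_minus_commute)
      next
        case False
        then show ?thesis using d(2)[of t s] s t by (simp add: dist_norm)
      qed
    qed
  qed
  then show ?thesis unfolding Y_def .
qed

text \<open>The equation in a Banach space type, to which the energy space is transported later.
  \<open>T t\<close> is constrained only for nonnegative \<open>t\<close>, hence the clamps
  \<open>max 0\<close> below; strong continuity is demanded only from the right at 0, since the
  semigroup law and the bound spread it.\<close>

locale semilinear_delay =
  fixes T :: "real \<Rightarrow> 'a::banach \<Rightarrow> 'a" and M \<omega> \<tau> \<beta> :: real and BB :: "'a \<Rightarrow> 'a" and k :: "real \<Rightarrow> real"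
  assumes T_linear: "t \<ge> 0 \<Longrightarrow> linear (T t)"
    and T_zero: "T 0 x = x"
    and T_add: "s \<ge> 0 \<Longrightarrow> t \<ge> 0 \<Longrightarrow> T (s + t) x = T s (T t x)"
    and T_cont0: "((\<lambda>t. T t x) \<longlongrightarrow> x) (at_right 0)"
    and T_bound: "t \<ge> 0 \<Longrightarrow> norm (T t x) \<le> M * exp (- \<omega> * t) * norm x"
    and M_pos: "M > 0" and \<omega>_nonneg: "\<omega> \<ge> 0" and \<tau>_pos: "\<tau> > 0"
    and BB_linear: "linear BB" and BB_bound: "norm (BB x) \<le> \<beta> * norm x" and \<beta>_nonneg: "\<beta> \<ge> 0"
    and k_int: "k absolutely_integrable_on {0..t}"
begin

definition mild :: "('a \<Rightarrow> 'a) \<Rightarrow> 'a \<Rightarrow> (real \<Rightarrow> 'a) \<Rightarrow> (real \<Rightarrow> 'a) \<Rightarrow> bool" where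
  "mild F U0 f U \<longleftrightarrow> continuous_on {0..} U \<and>
    (\<forall>t\<ge>0. ((\<lambda>s. T (t - s) (- k s *\<^sub>R (if s \<le> \<tau> then f (s - \<tau>) else BB (U (s - \<tau>))) + F (U s)))
      has_integral (U t - T t U0)) {0..t})"

definition conv :: "(real \<Rightarrow> real) \<Rightarrow> (real \<Rightarrow> 'a) \<Rightarrow> real \<Rightarrow> 'a" where
  "conv \<kappa> g t = integral {0..t} (\<lambda>s. \<kappa> s *\<^sub>R T (t - s) (g s))"

text \<open>Splitting the kernel at \<open>\<tau>\<close> leaves integrands that are kernels times continuous curves;
  clamping the time arguments below makes these curves total.\<close>

definition k1 :: "real \<Rightarrow> real" where "k1 s = (if s \<le> \<tau> then - k s else 0)"
definition k2 :: "real \<Rightarrow> real" where "k2 s = (if s \<le> \<tau> then 0 else - k s)"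

definition history :: "(real \<Rightarrow> 'a) \<Rightarrow> real \<Rightarrow> 'a" where "history f s = f (min s \<tau> - \<tau>)"
definition delayed :: "(real \<Rightarrow> 'a) \<Rightarrow> real \<Rightarrow> 'a" where "delayed U s = U (max 0 (s - \<tau>))"

definition duhamel :: "('a \<Rightarrow> 'a) \<Rightarrow> 'a \<Rightarrow> (real \<Rightarrow> 'a) \<Rightarrow> (real \<Rightarrow> 'a) \<Rightarrow> real \<Rightarrow> 'a" where
  "duhamel F U0 f U t = T t U0 + conv k1 (history f) t + conv k2 (\<lambda>s. BB (delayed U s)) t
     + conv (\<lambda>s. 1) (\<lambda>s. F (U s)) t"

lemma neg_k_int: "(\<lambda>s. - k s) absolutely_integrable_on {0..t}"
  using k_int[of t] by (auto simp: absolutely_integrable_on_def integrable_neg)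

lemma k1_int: "k1 absolutely_integrable_on {0..t}"
  and k2_int: "k2 absolutely_integrable_on {0..t}"
  unfolding k1_def k2_def
  using absolutely_integrable_truncate[OF neg_k_int] by blast+

lemma one_int: "(\<lambda>s. 1::real) absolutely_integrable_on {0..t::real}"
  by (intro absolutely_integrable_continuous_real continuous_intros)

section \<open>Boundedness and strong continuity of the semigroup\<close>

lemma T_bound': "t \<ge> 0 \<Longrightarrow> norm (T t x) \<le> M * norm x"
proof -
  assume t: "t \<ge> 0"
  have "exp (- \<omega> * t) \<le> 1" using t \<omega>_nonneg by simp
  then have "M * exp (- \<omega> * t) * norm x \<le> M * 1 * norm x"
    using M_pos by (intro mult_right_mono mult_left_mono) auto
  then show ?thesis using T_bound[OF t, of x] by simp
qed

lemma BB_continuous: "continuous_on A BB"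
proof -
  have "bounded_linear BB"
    using BB_linear BB_bound by (intro bounded_linear.intro bounded_linear_axioms.intro) (auto simp: mult.commute)
  then show ?thesis by (intro linear_continuous_on)
qed

text \<open>The increment between \<open>a < b\<close> is \<open>T a\<close> applied to
  \<open>T (b - a) x - x\<close>. Since \<open>T a\<close> is bounded by \<open>M\<close> uniformly
  in \<open>a\<close>, continuity at 0 gives continuity from both sides everywhere.\<close>

lemma T_strongly_continuous: "continuous_on {0..} (\<lambda>t. T t x)"
  unfolding continuous_on_iff
proof (intro ballI allI impI)
  fix t e :: real assume t: "t \<in> {0..}" and e: "e > 0"
  have "eventually (\<lambda>r. dist (T r x) x < e / M) (at_right 0)"
    using tendstoD[OF T_cont0] e M_pos by simp
  then obtain d where d: "d > 0" "\<And>r. 0 < r \<Longrightarrow> r < d \<Longrightarrow> norm (T r x - x) < e / M"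
    by (auto simp: eventually_at_right_field dist_norm)
  have *: "norm (T b x - T a x) < e" if ab: "0 \<le> a" "a < b" "b - a < d" for a b
  proof -
    have "T b x - T a x = T a (T (b - a) x) - T a x" using T_add[of a "b - a" x] ab by simp
    also have "\<dots> = T a (T (b - a) x - x)" using ab T_linear[of a] by (simp add: linear_diff)
    also have "norm \<dots> \<le> M * norm (T (b - a) x - x)" using T_bound'[of a] ab by simp
    also have "\<dots> < M * (e / M)" using d(2)[of "b - a"] ab M_pos by (intro mult_strict_left_mono) auto
    finally show ?thesis using M_pos by simp
  qed
  show "\<exists>d>0. \<forall>s\<in>{0..}. dist s t < d \<longrightarrow> dist (T s x) (T t x) < e"
  proof (intro exI[of _ d] conjI d(1) ballI impI)
    fix s assume s: "s \<in> {0..}" "dist s t < d"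
    show "dist (T s x) (T t x) < e"
      using *[of s t] *[of t s] s t e
      by (cases s t rule: linorder_cases) (auto simp: dist_norm norm_minus_commute)
  qed
qed

text \<open>Strong continuity in time and the uniform bound \<open>M\<close> give joint continuity:
  freeze the vector at \<open>g x\<close> and estimate the remainder \<open>g y - g x\<close> by
  \<open>M\<close>.\<close>

lemma continuous_on_T:
  fixes p :: "'b::topological_space \<Rightarrow> real"
  assumes p: "continuous_on A p" and g: "continuous_on A g"
  shows "continuous_on A (\<lambda>x. T (max 0 (p x)) (g x))"
  unfolding continuous_on_def
proof
  fix x assume x: "x \<in> A"
  have "continuous_on A (\<lambda>y. T (max 0 (p y)) (g x))"
    by (rule continuous_on_compose2[OF T_strongly_continuous]) (auto intro!: continuous_intros p)
  then have 1: "((\<lambda>y. T (max 0 (p y)) (g x)) \<longlongrightarrow> T (max 0 (p x)) (g x)) (at x within A)"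
    using x unfolding continuous_on_def by blast
  have "((\<lambda>y. M * norm (g y - g x)) \<longlongrightarrow> M * norm (g x - g x)) (at x within A)"
    using g x unfolding continuous_on_def by (intro tendsto_intros) blast
  then have 2: "((\<lambda>y. M * norm (g y - g x)) \<longlongrightarrow> 0) (at x within A)" by simp
  have "((\<lambda>y. T (max 0 (p y)) (g y - g x)) \<longlongrightarrow> 0) (at x within A)"
    by (rule Lim_null_comparison[OF _ 2]) (auto intro!: always_eventually T_bound')
  from tendsto_add[OF this 1]
  show "((\<lambda>y. T (max 0 (p y)) (g y)) \<longlongrightarrow> T (max 0 (p x)) (g x)) (at x within A)"
    using T_linear by (simp add: linear_diff)
qed

section \<open>Convolutions of a kernel with the semigroup\<close>

lemma T_curve_continuous:
  assumes "continuous_on {0..t} g"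
  shows "continuous_on {0..t} (\<lambda>s. T (t - s) (g s))"
proof -
  have "continuous_on {0..t} (\<lambda>s. T (max 0 (t - s)) (g s))"
    by (intro continuous_on_T assms continuous_intros)
  then show ?thesis by (rule continuous_on_eq) simp
qed

lemma conv_integrable:
  assumes "\<kappa> absolutely_integrable_on {0..t}" "continuous_on {0..t} g"
  shows "(\<lambda>s. \<kappa> s *\<^sub>R T (t - s) (g s)) integrable_on {0..t}"
  using assms(1) T_curve_continuous[OF assms(2)] by (rule integrable_kernel_continuous)

lemma conv_diff:
  assumes "\<kappa> absolutely_integrable_on {0..t}" "continuous_on {0..t} g" "continuous_on {0..t} h"
  shows "conv \<kappa> g t - conv \<kappa> h t = conv \<kappa> (\<lambda>s. g s - h s) t"
proof -
  have "conv \<kappa> (\<lambda>s. g s - h s) t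
      = integral {0..t} (\<lambda>s. \<kappa> s *\<^sub>R T (t - s) (g s) - \<kappa> s *\<^sub>R T (t - s) (h s))"
    unfolding conv_def using T_linear by (intro integral_cong) (simp add: linear_diff scaleR_diff_right)
  then show ?thesis
    unfolding conv_def using integral_diff[OF conv_integrable[OF assms(1,2)] conv_integrable[OF assms(1,3)]] by simp
qed

text \<open>Pulling \<open>exp (- \<omega> * t)\<close> out of the semigroup bound leaves
  \<open>exp (\<omega> * s)\<close> under the integral, the form in which Gronwall is applied to the
  weighted norm. The primed variant forgets the exponentials, which suffices for contraction and
  uniqueness.\<close>

lemma conv_bound:
  assumes \<kappa>: "\<kappa> absolutely_integrable_on {0..t}" and g: "continuous_on {0..t} g"
    and h: "continuous_on {0..t} h" "\<And>s. s \<in> {0..t} \<Longrightarrow> norm (g s) \<le> h s"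
  shows "norm (conv \<kappa> g t) \<le> exp (- \<omega> * t) * integral {0..t} (\<lambda>s. \<bar>\<kappa> s\<bar> * (M * exp (\<omega> * s) * h s))"
proof -
  have "norm (conv \<kappa> g t) \<le> integral {0..t} (\<lambda>s. \<bar>\<kappa> s\<bar> * (M * exp (- \<omega> * (t - s)) * h s))"
    unfolding conv_def
  proof (rule integral_kernel_norm_bound[OF \<kappa> T_curve_continuous[OF g]])
    show "continuous_on {0..t} (\<lambda>s. M * exp (- \<omega> * (t - s)) * h s)"
      by (intro continuous_intros h)
    show "norm (T (t - s) (g s)) \<le> M * exp (- \<omega> * (t - s)) * h s" if "s \<in> {0..t}" for s
      using T_bound[of "t - s" "g s"] h(2)[OF that] that M_pos
      by (intro order_trans[OF T_bound mult_left_mono]) auto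
  qed
  also have "\<dots> = integral {0..t} (\<lambda>s. exp (- \<omega> * t) * (\<bar>\<kappa> s\<bar> * (M * exp (\<omega> * s) * h s)))"
    by (intro integral_cong) (simp add: right_diff_distrib exp_diff exp_minus field_simps)
  finally show ?thesis by simp
qed

lemma conv_bound':
  assumes \<kappa>: "\<kappa> absolutely_integrable_on {0..t}" and g: "continuous_on {0..t} g"
    and h: "continuous_on {0..t} h" "\<And>s. s \<in> {0..t} \<Longrightarrow> norm (g s) \<le> h s"
  shows "norm (conv \<kappa> g t) \<le> integral {0..t} (\<lambda>s. \<bar>\<kappa> s\<bar> * (M * h s))"
  unfolding conv_def
proof (rule integral_kernel_norm_bound[OF \<kappa> T_curve_continuous[OF g]])
  show "continuous_on {0..t} (\<lambda>s. M * h s)" by (intro continuous_intros h)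
  show "norm (T (t - s) (g s)) \<le> M * h s" if "s \<in> {0..t}" for s
    using h(2)[OF that] that M_pos by (intro order_trans[OF T_bound' mult_left_mono]) auto
qed

lemma continuous_on_atLeast0I:
  assumes "\<And>N. N > 0 \<Longrightarrow> continuous_on {0..N} g"
  shows "continuous_on {0::real..} (g :: real \<Rightarrow> 'b::topological_space)"
  unfolding continuous_on_eq_continuous_within
proof
  fix t :: real assume t: "t \<in> {0..}"
  have "continuous (at t within {0..t + 1}) g"
    using assms[of "t + 1"] t by (auto simp: continuous_on_eq_continuous_within)
  moreover have "at t within {0..t + 1} = at t within {0..}"
    by (rule at_within_nhd[of _ "{..<t + 1}"]) auto
  ultimately show "continuous (at t within {0..}) g" by (simp add: continuous_within)
qed

lemma conv_continuous:
  assumes \<kappa>: "\<And>t. \<kappa> absolutely_integrable_on {0..t}" and g: "continuous_on {0..} g"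
  shows "continuous_on {0..} (conv \<kappa> g)"
proof (rule continuous_on_atLeast0I)
  fix N :: real assume N: "N > 0"
  \<comment> \<open>The clamped family is continuous on the full square and agrees with the
    integrand of the convolution for \<open>s \<le> t\<close>, the only region of
    integration.\<close>
  have "continuous_on ({0..N} \<times> {0..N}) (\<lambda>p. T (max 0 (fst p - snd p)) (g (snd p)))"
    by (intro continuous_on_T continuous_intros continuous_on_compose2[OF g]) auto
  then have "continuous_on ({0..N} \<times> {0..N}) (\<lambda>(t, s). T (max 0 (t - s)) (g s))"
    by (simp add: case_prod_beta)
  from continuous_on_volterra[OF this \<kappa>]
  show "continuous_on {0..N} (conv \<kappa> g)"
    by (rule continuous_on_eq) (auto simp: conv_def intro!: integral_cong)
qed

section \<open>Duhamel's formula as a fixed point equation\<close>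

lemma history_continuous: "continuous_on {- \<tau>..0} f \<Longrightarrow> continuous_on {0..} (history f)"
  unfolding history_def
  by (rule continuous_on_compose2[of "{- \<tau>..0}" f]) (use \<tau>_pos in \<open>auto intro!: continuous_intros\<close>)

lemma delayed_continuous: "continuous_on {0..} U \<Longrightarrow> continuous_on {0..} (delayed U)"
  unfolding delayed_def
  by (rule continuous_on_compose2[of "{0..}" U]) (auto intro!: continuous_intros)

lemma BB_delayed_continuous: "continuous_on {0..} U \<Longrightarrow> continuous_on {0..} (\<lambda>s. BB (delayed U s))"
  by (rule continuous_on_compose2[OF BB_continuous[of UNIV] delayed_continuous]) auto

lemma continuous_on_restrict0: "continuous_on {0..} g \<Longrightarrow> continuous_on {0..t::real} g"
  by (rule continuous_on_subset) auto

text \<open>The kernels \<open>k1\<close> and \<open>k2\<close> have disjoint supports, and each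
  clamp is inert where its kernel acts, so by linearity the three convolution integrands add up to
  the integrand of \<open>mild\<close>; the point \<open>s = \<tau>\<close> belongs to the history
  on both sides. Uniqueness of the integral gives the equivalence.\<close>

lemma mild_iff_duhamel:
  assumes F: "continuous_on UNIV F" and f: "continuous_on {- \<tau>..0} f"
  shows "mild F U0 f U \<longleftrightarrow> continuous_on {0..} U \<and> (\<forall>t\<ge>0. U t = duhamel F U0 f U t)"
proof (cases "continuous_on {0..} U")
  case U: True
  have "((\<lambda>s. T (t - s) (- k s *\<^sub>R (if s \<le> \<tau> then f (s - \<tau>) else BB (U (s - \<tau>))) + F (U s)))
      has_integral (U t - T t U0)) {0..t} \<longleftrightarrow> U t = duhamel F U0 f U t" (is "(?I has_integral _) _ \<longleftrightarrow> _")
    if t: "t \<ge> 0" for t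
  proof -
    have FU: "continuous_on {0..} (\<lambda>s. F (U s))"
      by (rule continuous_on_compose2[OF F U]) auto
    note hi = conv_integrable[OF k1_int continuous_on_restrict0[OF history_continuous[OF f]], of t]
      conv_integrable[OF k2_int continuous_on_restrict0[OF BB_delayed_continuous[OF U]], of t]
      conv_integrable[OF one_int continuous_on_restrict0[OF FU], of t]
    have "((\<lambda>s. k1 s *\<^sub>R T (t - s) (history f s) + k2 s *\<^sub>R T (t - s) (BB (delayed U s))
        + 1 *\<^sub>R T (t - s) (F (U s))) has_integral
        (conv k1 (history f) t + conv k2 (\<lambda>s. BB (delayed U s)) t + conv (\<lambda>s. 1) (\<lambda>s. F (U s)) t)) {0..t}"
      unfolding conv_def by (intro has_integral_add integrable_integral hi)
    then have "(?I has_integral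
        (conv k1 (history f) t + conv k2 (\<lambda>s. BB (delayed U s)) t + conv (\<lambda>s. 1) (\<lambda>s. F (U s)) t)) {0..t}"
    proof (rule has_integral_eq[rotated])
      fix s assume s: "s \<in> {0..t}"
      have lin: "linear (T (t - s))" using s by (intro T_linear) auto
      show "k1 s *\<^sub>R T (t - s) (history f s) + k2 s *\<^sub>R T (t - s) (BB (delayed U s)) + 1 *\<^sub>R T (t - s) (F (U s)) = ?I s"
        using s by (simp add: k1_def k2_def history_def delayed_def linear_add[OF lin] linear_diff[OF lin]
            linear_cmul[OF lin] linear_neg[OF lin])
    qed
    then have I: "(?I has_integral (duhamel F U0 f U t - T t U0)) {0..t}"
      by (simp add: duhamel_def add.assoc)
    show ?thesis
    proof
      assume "(?I has_integral (U t - T t U0)) {0..t}"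
      from has_integral_unique[OF this I] show "U t = duhamel F U0 f U t" by simp
    qed (use I in simp)
  qed
  then show ?thesis using U by (simp add: mild_def)
qed (simp add: mild_def)

lemma zero_maps [simp]: "BB 0 = 0" "t \<ge> 0 \<Longrightarrow> T t 0 = 0"
  using BB_linear T_linear by (simp_all add: linear_0)

lemma k_abs_int: "(\<lambda>s. \<bar>k s\<bar>) absolutely_integrable_on {0..t}"
  using k_int[of t] by (auto simp: absolutely_integrable_on_def)

text \<open>The kernel stops at \<open>\<tau>\<close>, so the bound does not depend on
  \<open>t\<close>. The common upper limit \<open>max t \<tau>\<close> in the proof treats times
  before and after the delay together.\<close>

lemma history_term_le:
  assumes h: "continuous_on {0..} h" "\<And>s. s \<ge> 0 \<Longrightarrow> h s \<ge> 0"
  shows "integral {0..t} (\<lambda>s. \<bar>k1 s\<bar> * h s) \<le> integral {0..\<tau>} (\<lambda>s. \<bar>k s\<bar> * h s)"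
proof -
  define N where "N = max t \<tau>"
  have int: "(\<lambda>s. \<bar>k1 s\<bar> * h s) integrable_on {0..N}"
    using integrable_kernel_continuous[OF absolutely_integrable_abs[OF k1_int] continuous_on_restrict0[OF h(1)]]
    by simp
  have "integral {0..t} (\<lambda>s. \<bar>k1 s\<bar> * h s) \<le> integral {0..N} (\<lambda>s. \<bar>k1 s\<bar> * h s)"
    using h(2) by (intro integral_nonneg_le_superinterval int) (auto simp: N_def)
  also have "\<dots> = integral {0..\<tau>} (\<lambda>s. \<bar>k1 s\<bar> * h s) + integral {\<tau>..N} (\<lambda>s. \<bar>k1 s\<bar> * h s)"
    using \<tau>_pos by (intro Henstock_Kurzweil_Integration.integral_combine[symmetric] int) (auto simp: N_def)
  also have "integral {0..\<tau>} (\<lambda>s. \<bar>k1 s\<bar> * h s) = integral {0..\<tau>} (\<lambda>s. \<bar>k s\<bar> * h s)"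
    by (intro integral_cong) (simp add: k1_def)
  also have "integral {\<tau>..N} (\<lambda>s. \<bar>k1 s\<bar> * h s) = integral {\<tau>..N} (\<lambda>s. 0)"
    by (rule integral_spike[of "{\<tau>}"]) (auto simp: k1_def)
  finally show ?thesis by simp
qed

lemma abs_k2: "\<bar>k2 s\<bar> = (if s \<le> \<tau> then 0 else \<bar>k s\<bar>)" by (simp add: k2_def)

section \<open>Contraction estimate and global existence for a Lipschitz source\<close>

lemma duhamel_diff:
  assumes F: "continuous_on UNIV F" and U: "continuous_on {0..} U" and V: "continuous_on {0..} V"
  shows "duhamel F U0 f U t - duhamel F U0 f V t
    = conv k2 (\<lambda>s. BB (delayed U s) - BB (delayed V s)) t + conv (\<lambda>s. 1) (\<lambda>s. F (U s) - F (V s)) t"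
proof -
  have FU: "continuous_on {0..} (\<lambda>s. F (U s))" and FV: "continuous_on {0..} (\<lambda>s. F (V s))"
    by (rule continuous_on_compose2[OF F]; use U V in auto)+
  show ?thesis
    unfolding duhamel_def
    using conv_diff[OF k2_int continuous_on_restrict0[OF BB_delayed_continuous[OF U]]
        continuous_on_restrict0[OF BB_delayed_continuous[OF V]], of t]
      conv_diff[OF one_int continuous_on_restrict0[OF FU] continuous_on_restrict0[OF FV], of t]
    by (simp add: algebra_simps)
qed

lemma BB_diff_bound: "norm (BB x - BB y) \<le> \<beta> * norm (x - y)"
  using BB_bound[of "x - y"] BB_linear by (simp add: linear_diff)

lemma duhamel_diff_bound:
  assumes F: "continuous_on UNIV F" and U: "continuous_on {0..} U" and V: "continuous_on {0..} V"
    and w: "continuous_on {0..t} w" "continuous_on {0..t} w'"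
    and dw: "\<And>s. s \<in> {0..t} \<Longrightarrow> norm (F (U s) - F (V s)) \<le> w s"
      "\<And>s. s \<in> {0..t} \<Longrightarrow> norm (delayed U s - delayed V s) \<le> w' s"
  shows "norm (duhamel F U0 f U t - duhamel F U0 f V t)
    \<le> integral {0..t} (\<lambda>s. \<bar>k2 s\<bar> * (M * (\<beta> * w' s))) + integral {0..t} (\<lambda>s. M * w s)"
proof -
  have FU: "continuous_on {0..} (\<lambda>s. F (U s))" and FV: "continuous_on {0..} (\<lambda>s. F (V s))"
    by (rule continuous_on_compose2[OF F]; use U V in auto)+
  have "norm (conv k2 (\<lambda>s. BB (delayed U s) - BB (delayed V s)) t)
      \<le> integral {0..t} (\<lambda>s. \<bar>k2 s\<bar> * (M * (\<beta> * w' s)))"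
  proof (rule conv_bound'[OF k2_int])
    show "continuous_on {0..t} (\<lambda>s. BB (delayed U s) - BB (delayed V s))"
      using BB_delayed_continuous[OF U] BB_delayed_continuous[OF V]
      by (intro continuous_on_diff continuous_on_restrict0)
    show "norm (BB (delayed U s) - BB (delayed V s)) \<le> \<beta> * w' s" if "s \<in> {0..t}" for s
      using BB_diff_bound mult_left_mono[OF dw(2)[OF that] \<beta>_nonneg] by (rule order_trans)
  qed (intro continuous_intros w)
  moreover have "norm (conv (\<lambda>s. 1) (\<lambda>s. F (U s) - F (V s)) t) \<le> integral {0..t} (\<lambda>s. \<bar>1\<bar> * (M * w s))"
    by (rule conv_bound'[OF one_int])
      (auto intro!: continuous_on_diff continuous_on_restrict0 FU FV w dw)
  ultimately show ?thesis
    unfolding duhamel_diff[OF F U V] using norm_triangle_mono by fastforce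
qed

lemma duhamel_continuous:
  assumes F: "continuous_on UNIV F" and f: "continuous_on {- \<tau>..0} f" and U: "continuous_on {0..} U"
  shows "continuous_on {0..} (duhamel F U0 f U)"
proof -
  have FU: "continuous_on {0..} (\<lambda>s. F (U s))"
    by (rule continuous_on_compose2[OF F U]) auto
  show ?thesis
    unfolding duhamel_def
    by (intro continuous_on_add T_strongly_continuous conv_continuous k1_int k2_int one_int
        history_continuous f BB_delayed_continuous U FU)
qed

lemma mild_solution_exists:
  assumes F: "\<And>x y. norm (F x - F y) \<le> \<Lambda> * norm (x - y)" "F 0 = 0" and \<Lambda>: "\<Lambda> \<ge> 0"
    and f: "continuous_on {- \<tau>..0} f"
  shows "\<exists>U. mild F U0 f U"
proof -
  have F_cont: "continuous_on UNIV F"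
    using F(1) \<Lambda> by (intro lipschitz_on_continuous_on[of \<Lambda>] lipschitz_onI) (auto simp: dist_norm)
  \<comment> \<open>\<open>a\<close> collects the Lipschitz coefficients of the delayed term and of
    the source, multiplied by the semigroup bound. Measured against \<open>exp (4 * m t)\<close>,
    one application of Duhamel's formula gains the factor one half on the whole half line at
    once.\<close>
  define a where "a s = M * (\<beta> * \<bar>k s\<bar> + \<Lambda>)" for s
  define m where "m t = integral {0..t} a" for t
  \<comment> \<open>Being 1 at negative times, the weight is defined on the whole line, as are the
    bounded continuous functions used below.\<close>
  define w where "w t = exp (4 * m (max 0 t))" for t
  have a_int: "a integrable_on {0..t}" for t
    unfolding a_def using k_abs_int[of t]
    by (intro integrable_on_mult_right integrable_add integrable_const_ivl) (auto simp: absolutely_integrable_on_def)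
  have a_nonneg: "a s \<ge> 0" for s using M_pos \<beta>_nonneg \<Lambda> by (simp add: a_def)
  have m_cont: "continuous_on {0..} m"
    unfolding m_def by (rule continuous_on_atLeast0I indefinite_integral_continuous_1 a_int)+
  have w_cont: "continuous_on A w" for A
    unfolding w_def by (intro continuous_intros continuous_on_compose2[OF m_cont]) auto
  have m_mono: "m s \<le> m t" if "s \<le> t" for s t
    unfolding m_def using that a_nonneg by (intro integral_nonneg_le_superinterval a_int) auto
  have w_mono: "w s \<le> w t" if "s \<le> t" for s t
    unfolding w_def using that by (auto intro: m_mono)
  have w_ge1: "w t \<ge> 1" for t
    using m_mono[of 0 "max 0 t"] by (simp add: w_def m_def)
  have contraction: "norm (duhamel F U0 f U t - duhamel F U0 f V t) \<le> D * w t / 2"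
    if U: "continuous_on {0..} U" and V: "continuous_on {0..} V"
      and UV: "\<And>s. s \<ge> 0 \<Longrightarrow> norm (U s - V s) \<le> D * w s" and t: "t \<ge> 0" for U V D t
  proof -
    have D: "D \<ge> 0" using order_trans[OF norm_ge_zero UV[of 0]] w_ge1[of 0] by (simp add: zero_le_mult_iff)
    have "norm (duhamel F U0 f U t - duhamel F U0 f V t)
        \<le> integral {0..t} (\<lambda>s. \<bar>k2 s\<bar> * (M * (\<beta> * (D * w s)))) + integral {0..t} (\<lambda>s. M * (\<Lambda> * (D * w s)))"
    proof (rule duhamel_diff_bound[OF F_cont U V])
      show "norm (F (U s) - F (V s)) \<le> \<Lambda> * (D * w s)" if "s \<in> {0..t}" for s
        using F(1) mult_left_mono[OF UV \<Lambda>] that by (meson atLeastAtMost_iff order_trans)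
      show "norm (delayed U s - delayed V s) \<le> D * w s" if "s \<in> {0..t}" for s
      proof -
        \<comment> \<open>The delay is harmless because the weight is increasing: an earlier value
          carries a smaller weight.\<close>
        have "D * w (max 0 (s - \<tau>)) \<le> D * w s"
          using that \<tau>_pos D by (intro mult_left_mono w_mono) auto
        then show ?thesis using UV[of "max 0 (s - \<tau>)"] by (simp add: delayed_def)
      qed
    qed (intro continuous_intros w_cont)+
    also have "integral {0..t} (\<lambda>s. \<bar>k2 s\<bar> * (M * (\<beta> * (D * w s)))) \<le> integral {0..t} (\<lambda>s. \<bar>k s\<bar> * (M * (\<beta> * (D * w s))))"
    proof (rule integral_le)
      have c: "continuous_on {0..t} (\<lambda>s. M * (\<beta> * (D * w s)))" by (intro continuous_intros w_cont)
      show "(\<lambda>s. \<bar>k2 s\<bar> * (M * (\<beta> * (D * w s)))) integrable_on {0..t}"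
        using integrable_kernel_continuous[OF absolutely_integrable_abs[OF k2_int] c] by simp
      show "(\<lambda>s. \<bar>k s\<bar> * (M * (\<beta> * (D * w s)))) integrable_on {0..t}"
        using integrable_kernel_continuous[OF k_abs_int c] by simp
      show "\<bar>k2 s\<bar> * (M * (\<beta> * (D * w s))) \<le> \<bar>k s\<bar> * (M * (\<beta> * (D * w s)))" for s
        using M_pos \<beta>_nonneg D w_ge1[of s] by (intro mult_right_mono mult_nonneg_nonneg) (auto simp: k2_def)
    qed
    also have "integral {0..t} (\<lambda>s. \<bar>k s\<bar> * (M * (\<beta> * (D * w s)))) + integral {0..t} (\<lambda>s. M * (\<Lambda> * (D * w s)))
        = integral {0..t} (\<lambda>s. \<bar>k s\<bar> * (M * (\<beta> * (D * w s))) + M * (\<Lambda> * (D * w s)))"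
    proof (rule integral_add[symmetric])
      show "(\<lambda>s. \<bar>k s\<bar> * (M * (\<beta> * (D * w s)))) integrable_on {0..t}"
        using integrable_kernel_continuous[OF k_abs_int, of t "\<lambda>s. M * (\<beta> * (D * w s))"]
        by (simp add: continuous_intros w_cont)
    qed (intro integrable_continuous_interval continuous_intros w_cont)
    also have "\<dots> = integral {0..t} (\<lambda>s. D * (a s * exp (4 * integral {0..s} a)))"
      by (intro integral_cong) (simp add: a_def w_def m_def algebra_simps)
    also have "\<dots> = D * integral {0..t} (\<lambda>s. a s * exp (4 * integral {0..s} a))" by simp
    also have "\<dots> \<le> D * (exp (4 * integral {0..t} a) / 2)"
      using t D a_int a_nonneg by (intro mult_left_mono integral_weight_exp_primitive) auto
    finally show ?thesis using t by (simp add: w_def m_def)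
  qed
  obtain Q where Q: "Q > 0" "\<And>s. s \<in> {0..\<tau>} \<Longrightarrow> norm (history f s) \<le> Q"
  proof -
    have "compact (history f ` {0..\<tau>})"
      by (intro compact_continuous_image continuous_on_restrict0 history_continuous f compact_Icc)
    then show ?thesis using that by (auto dest!: compact_imp_bounded simp: bounded_pos)
  qed
  have Q': "norm (history f s) \<le> Q" if "s \<ge> 0" for s
    using Q(2)[of "min s \<tau>"] that \<tau>_pos by (auto simp: history_def)
  \<comment> \<open>Bounds the image of the zero curve uniformly in time; together with the
    contraction estimate it keeps the iteration among bounded functions.\<close>
  define B0 where "B0 = M * norm U0 + integral {0..\<tau>} (\<lambda>s. \<bar>k s\<bar> * (M * Q))"
  have base: "norm (duhamel F U0 f (\<lambda>_. 0) t) \<le> B0" if t: "t \<ge> 0" for t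
  proof -
    have "conv \<kappa> (\<lambda>s. 0) t = 0" for \<kappa>
      unfolding conv_def by (intro integral_unique has_integral_is_0) simp
    then have "duhamel F U0 f (\<lambda>_. 0) t = T t U0 + conv k1 (history f) t"
      by (simp add: duhamel_def delayed_def F)
    moreover have "norm (conv k1 (history f) t) \<le> integral {0..t} (\<lambda>s. \<bar>k1 s\<bar> * (M * Q))"
      by (rule conv_bound'[OF k1_int]) (auto intro!: continuous_on_restrict0 history_continuous f Q')
    moreover have "\<dots> \<le> integral {0..\<tau>} (\<lambda>s. \<bar>k s\<bar> * (M * Q))"
      using M_pos Q(1) by (intro history_term_le) auto
    ultimately show ?thesis
      unfolding B0_def using T_bound'[OF t, of U0] norm_triangle_ineq[of "T t U0" "conv k1 (history f) t"] by simp
  qed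
  have B0: "B0 \<ge> 0" using order_trans[OF norm_ge_zero base[of 0]] by simp
  \<comment> \<open>The unknown \<open>W\<close> is the curve divided by the weight, so that the
    weighted sup norm becomes the norm of bounded continuous functions; \<open>\<Psi>\<close> is
    Duhamel's operator in this variable.\<close>
  define Uc where "Uc W t = w t *\<^sub>R apply_bcontfun W t" for W :: "real \<Rightarrow>\<^sub>C 'a" and t
  define \<Psi> where "\<Psi> W t = (1 / w t) *\<^sub>R duhamel F U0 f (Uc W) (max 0 t)" for W :: "real \<Rightarrow>\<^sub>C 'a" and t
  have Uc_cont: "continuous_on {0..} (Uc W)" for W
    unfolding Uc_def by (intro continuous_intros w_cont continuous_on_apply_bcontfun)
  have w_max: "w (max 0 t) = w t" for t by (simp add: w_def)
  have \<Psi>_in: "\<Psi> W \<in> bcontfun" for W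
  proof (rule bcontfun_normI)
    have "w t \<noteq> 0" for t using w_ge1[of t] by linarith
    then show "continuous_on UNIV (\<Psi> W)"
      unfolding \<Psi>_def
      by (intro continuous_intros w_cont continuous_on_compose2[OF duhamel_continuous[OF F_cont f Uc_cont]]) auto
    fix t
    have "norm (duhamel F U0 f (Uc W) (max 0 t) - duhamel F U0 f (\<lambda>_. 0) (max 0 t)) \<le> norm W * w (max 0 t) / 2"
    proof (rule contraction[OF Uc_cont])
      show "norm (Uc W s - 0) \<le> norm W * w s" for s
        using norm_bounded[of W s] w_ge1[of s] by (simp add: Uc_def mult.commute mult_left_mono)
    qed auto
    then have "norm (duhamel F U0 f (Uc W) (max 0 t)) \<le> norm W * w t / 2 + B0"
      using base[of "max 0 t"] norm_triangle_sub[of "duhamel F U0 f (Uc W) (max 0 t)" "duhamel F U0 f (\<lambda>_. 0) (max 0 t)"]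
      by (simp add: w_max)
    also have "\<dots> \<le> w t * (norm W / 2 + B0)"
      using mult_left_mono[OF w_ge1 B0, of t] by (simp add: algebra_simps)
    finally show "norm (\<Psi> W t) \<le> norm W / 2 + B0"
      using w_ge1[of t] by (simp add: \<Psi>_def field_simps)
  qed
  have "\<exists>!W. Bcontfun (\<Psi> W) = W"
  proof (rule banach_fix_type[of "1/2"])
    show "\<forall>W V. dist (Bcontfun (\<Psi> W)) (Bcontfun (\<Psi> V)) \<le> 1 / 2 * dist W V"
    proof (intro allI dist_bound)
      fix W V t
      have "norm (duhamel F U0 f (Uc W) (max 0 t) - duhamel F U0 f (Uc V) (max 0 t)) \<le> dist W V * w (max 0 t) / 2"
      proof (rule contraction[OF Uc_cont Uc_cont])
        show "norm (Uc W s - Uc V s) \<le> dist W V * w s" for s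
        proof -
          have "Uc W s - Uc V s = w s *\<^sub>R (apply_bcontfun W s - apply_bcontfun V s)"
            by (simp only: Uc_def scaleR_diff_right)
          then have "norm (Uc W s - Uc V s) = w s * dist (apply_bcontfun W s) (apply_bcontfun V s)"
            using w_ge1[of s] by (simp only: norm_scaleR dist_norm)
          also have "\<dots> \<le> w s * dist W V"
            using dist_bounded w_ge1[of s] by (intro mult_left_mono) auto
          finally show ?thesis by (simp only: mult.commute)
        qed
      qed auto
      then have le: "norm (duhamel F U0 f (Uc W) (max 0 t) - duhamel F U0 f (Uc V) (max 0 t)) \<le> w t * (dist W V / 2)"
        by (simp add: w_max mult.commute)
      have "\<Psi> W t - \<Psi> V t = (1 / w t) *\<^sub>R (duhamel F U0 f (Uc W) (max 0 t) - duhamel F U0 f (Uc V) (max 0 t))"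
        by (simp only: \<Psi>_def scaleR_diff_right)
      then have "norm (\<Psi> W t - \<Psi> V t)
          = norm (duhamel F U0 f (Uc W) (max 0 t) - duhamel F U0 f (Uc V) (max 0 t)) / w t"
        using w_ge1[of t] by (simp only: norm_scaleR) simp
      also have "\<dots> \<le> dist W V / 2"
        using le w_ge1[of t] by (simp add: pos_divide_le_eq mult.commute)
      finally show "dist (apply_bcontfun (Bcontfun (\<Psi> W)) t) (apply_bcontfun (Bcontfun (\<Psi> V)) t) \<le> 1 / 2 * dist W V"
        by (simp add: Bcontfun_inverse[OF \<Psi>_in] dist_norm)
    qed
  qed auto
  then obtain W where W: "Bcontfun (\<Psi> W) = W" by blast
  then have W_eq: "apply_bcontfun W t = \<Psi> W t" for t
    using Bcontfun_inverse[OF \<Psi>_in[of W]] by metis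
  have "Uc W t = duhamel F U0 f (Uc W) t" if "t \<ge> 0" for t
    using w_ge1[of t] that by (subst Uc_def) (simp add: W_eq \<Psi>_def)
  then show ?thesis
    using mild_iff_duhamel[OF F_cont f] Uc_cont by blast
qed

section \<open>Decay estimate and uniqueness\<close>

lemma mild_solution_decay:
  assumes F: "continuous_on UNIV F" and f: "continuous_on {- \<tau>..0} f"
    and U: "mild F U0 f U" and l: "l \<ge> 0" and FU: "\<And>s. s \<ge> 0 \<Longrightarrow> norm (F (U s)) \<le> l * norm (U s)"
    and \<gamma>: "\<gamma> \<ge> 0"
    and growth: "\<And>t. t > 0 \<Longrightarrow> M * \<beta> * exp (\<omega> * \<tau>) * integral {0..t} (\<lambda>s. \<bar>k (s + \<tau>)\<bar>) \<le> \<gamma> + \<omega>' * t"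
    and t: "t \<ge> 0"
  shows "norm (U t) \<le> M * exp \<gamma> * (norm U0 + integral {0..\<tau>} (\<lambda>s. exp (\<omega> * s) * \<bar>k s\<bar> * norm (f (s - \<tau>))))
    * exp (- (\<omega> - \<omega>' - M * l) * t)"
proof -
  have U_cont: "continuous_on {0..} U" and U_eq: "\<And>t. t \<ge> 0 \<Longrightarrow> U t = duhamel F U0 f U t"
    using U mild_iff_duhamel[OF F f] by blast+
  have FU_cont: "continuous_on {0..} (\<lambda>s. F (U s))"
    by (rule continuous_on_compose2[OF F U_cont]) auto
  define u where "u s = exp (\<omega> * s) * norm (U s)" for s
  \<comment> \<open>The factor \<open>exp (\<omega> * \<tau>)\<close> remains when
    \<open>exp (\<omega> * s)\<close> is split so that \<open>exp (\<omega> * (s - \<tau>))\<close>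
    completes the delayed value of \<open>u\<close>.\<close>
  define \<kappa> where "\<kappa> s = M * \<beta> * exp (\<omega> * \<tau>) * \<bar>k s\<bar>" for s
  define D where "D = norm U0 + integral {0..\<tau>} (\<lambda>s. exp (\<omega> * s) * \<bar>k s\<bar> * norm (f (s - \<tau>)))"
  have u_cont: "continuous_on {0..} u"
    unfolding u_def by (intro continuous_intros U_cont)
  have hist_cont: "continuous_on {0..} (\<lambda>s. M * exp (\<omega> * s) * norm (history f s))"
    by (intro continuous_intros history_continuous f)
  have hist: "integral {0..\<tau>} (\<lambda>s. \<bar>k s\<bar> * (M * exp (\<omega> * s) * norm (history f s)))
      = M * integral {0..\<tau>} (\<lambda>s. exp (\<omega> * s) * \<bar>k s\<bar> * norm (f (s - \<tau>)))"
    by (simp flip: integral_mult_right, intro integral_cong) (auto simp: history_def)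
  have hist_nonneg: "integral {0..\<tau>} (\<lambda>s. \<bar>k s\<bar> * (M * exp (\<omega> * s) * norm (history f s))) \<ge> 0"
    using integrable_kernel_continuous[OF k_abs_int continuous_on_restrict0[OF hist_cont], of \<tau>] M_pos
    by (intro integral_nonneg) auto
  have D: "D \<ge> 0" using hist_nonneg M_pos unfolding hist D_def by (simp add: zero_le_mult_iff)
  have "u t \<le> M * D * exp (integral {0..t} (\<lambda>s. \<kappa> (s + \<tau>)) + M * l * t)"
  proof (rule gronwall_delay[OF \<tau>_pos t])
    show "M * D \<ge> 0" "M * l \<ge> 0" using M_pos D l by simp_all
    show "\<kappa> integrable_on {0..T}" for T
      unfolding \<kappa>_def using k_abs_int by (intro integrable_on_mult_right) (auto simp: absolutely_integrable_on_def)
    show "\<kappa> s \<ge> 0" for s using M_pos \<beta>_nonneg by (simp add: \<kappa>_def)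
    show "continuous_on {0..t} u" by (rule continuous_on_restrict0[OF u_cont])
    show "u s \<ge> 0" for s by (simp add: u_def)
    fix x assume "x \<in> {0..t}"
    then have x: "x \<ge> 0" by simp
    have b1: "norm (conv k1 (history f) x)
        \<le> exp (- \<omega> * x) * integral {0..x} (\<lambda>s. \<bar>k1 s\<bar> * (M * exp (\<omega> * s) * norm (history f s)))"
      by (intro conv_bound k1_int continuous_on_restrict0 history_continuous f continuous_on_norm order_refl)
    have b2: "norm (conv k2 (\<lambda>s. BB (delayed U s)) x)
        \<le> exp (- \<omega> * x) * integral {0..x} (\<lambda>s. \<bar>k2 s\<bar> * (M * exp (\<omega> * s) * (\<beta> * norm (delayed U s))))"
      by (intro conv_bound k2_int continuous_on_restrict0 BB_delayed_continuous delayed_continuous U_cont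
          continuous_intros BB_bound)
    have b3: "norm (conv (\<lambda>s. 1) (\<lambda>s. F (U s)) x)
        \<le> exp (- \<omega> * x) * integral {0..x} (\<lambda>s. \<bar>1\<bar> * (M * exp (\<omega> * s) * (l * norm (U s))))"
      by (intro conv_bound one_int continuous_on_restrict0 U_cont FU_cont continuous_intros FU) auto
    have i1: "integral {0..x} (\<lambda>s. \<bar>k1 s\<bar> * (M * exp (\<omega> * s) * norm (history f s)))
        \<le> M * integral {0..\<tau>} (\<lambda>s. exp (\<omega> * s) * \<bar>k s\<bar> * norm (f (s - \<tau>)))"
      unfolding hist[symmetric] using M_pos by (intro history_term_le hist_cont) auto
    have i2: "integral {0..x} (\<lambda>s. \<bar>k2 s\<bar> * (M * exp (\<omega> * s) * (\<beta> * norm (delayed U s))))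
        = integral {0..x} (\<lambda>s. (if s \<le> \<tau> then 0 else \<kappa> s) * u (max 0 (s - \<tau>)))"
    proof (intro integral_cong)
      fix s
      show "\<bar>k2 s\<bar> * (M * exp (\<omega> * s) * (\<beta> * norm (delayed U s)))
          = (if s \<le> \<tau> then 0 else \<kappa> s) * u (max 0 (s - \<tau>))"
        by (simp add: abs_k2 \<kappa>_def u_def delayed_def right_diff_distrib exp_diff)
    qed
    have i3: "integral {0..x} (\<lambda>s. \<bar>1\<bar> * (M * exp (\<omega> * s) * (l * norm (U s)))) = M * l * integral {0..x} u"
      by (simp flip: integral_mult_right add: u_def mult_ac)
    have "norm (U x) \<le> norm (T x U0) + norm (conv k1 (history f) x)
        + norm (conv k2 (\<lambda>s. BB (delayed U s)) x) + norm (conv (\<lambda>s. 1) (\<lambda>s. F (U s)) x)"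
      unfolding U_eq[OF x] duhamel_def by (intro norm_triangle_le add_mono order_refl norm_triangle_ineq)
    also have "\<dots> \<le> exp (- \<omega> * x) * (M * norm U0
        + integral {0..x} (\<lambda>s. \<bar>k1 s\<bar> * (M * exp (\<omega> * s) * norm (history f s)))
        + integral {0..x} (\<lambda>s. (if s \<le> \<tau> then 0 else \<kappa> s) * u (max 0 (s - \<tau>))) + M * l * integral {0..x} u)"
      using T_bound[OF x, of U0] b1 b2 b3 unfolding i2 i3 distrib_left by (simp add: mult_ac)
    also have "\<dots> \<le> exp (- \<omega> * x) * (M * D
        + integral {0..x} (\<lambda>s. (if s \<le> \<tau> then 0 else \<kappa> s) * u (max 0 (s - \<tau>))) + M * l * integral {0..x} u)"
      using i1 unfolding D_def distrib_left[of M] by (intro mult_left_mono) auto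
    finally have "exp (\<omega> * x) * norm (U x) \<le> exp (\<omega> * x) * (exp (- \<omega> * x) * (M * D
        + integral {0..x} (\<lambda>s. (if s \<le> \<tau> then 0 else \<kappa> s) * u (max 0 (s - \<tau>))) + M * l * integral {0..x} u))"
      by (intro mult_left_mono) auto
    then show "u x \<le> M * D
        + integral {0..x} (\<lambda>s. (if s \<le> \<tau> then 0 else \<kappa> s) * u (max 0 (s - \<tau>))) + M * l * integral {0..x} u"
      by (simp add: u_def mult.assoc[symmetric] exp_add[symmetric])
  qed
  also have "\<dots> \<le> M * D * exp (\<gamma> + \<omega>' * t + M * l * t)"
  proof -
    have "integral {0..t} (\<lambda>s. \<kappa> (s + \<tau>)) \<le> \<gamma> + \<omega>' * t"
    \<comment> \<open>The growth hypothesis speaks of \<open>t > 0\<close>; at 0 the integral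
      vanishes and \<open>\<gamma> \<ge> 0\<close> is enough.\<close>
    proof (cases "t = 0")
      case False
      then show ?thesis using growth[of t] t by (simp add: \<kappa>_def)
    qed (simp add: \<gamma>)
    then show ?thesis using M_pos D by (intro mult_left_mono) auto
  qed
  finally have "exp (- \<omega> * t) * (exp (\<omega> * t) * norm (U t)) \<le> exp (- \<omega> * t) * (M * D * exp (\<gamma> + \<omega>' * t + M * l * t))"
    unfolding u_def by (rule mult_left_mono) simp
  also have "exp (- \<omega> * t) * (exp (\<omega> * t) * norm (U t)) = norm (U t)"
    by (simp add: mult.assoc[symmetric] exp_add[symmetric])
  also have "exp (- \<omega> * t) * (M * D * exp (\<gamma> + \<omega>' * t + M * l * t))
      = M * D * (exp (- \<omega> * t) * exp (\<gamma> + \<omega>' * t + M * l * t))" by simp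
  also have "exp (- \<omega> * t) * exp (\<gamma> + \<omega>' * t + M * l * t) = exp \<gamma> * exp (- (\<omega> - \<omega>' - M * l) * t)"
    by (simp add: exp_add[symmetric] algebra_simps)
  finally show ?thesis by (simp add: D_def mult_ac)
qed

text \<open>On \<open>{0..t}\<close> both solutions are bounded by compactness, so a Lipschitz
  constant on one ball suffices. The free evolution and the history cancel in the difference, and
  Gronwall applies with initial constant 0.\<close>

lemma mild_solution_unique:
  assumes F: "continuous_on UNIV F" and f: "continuous_on {- \<tau>..0} f"
    and lip: "\<And>r. r > 0 \<Longrightarrow> \<exists>\<Lambda>\<ge>0. \<forall>x y. norm x \<le> r \<longrightarrow> norm y \<le> r \<longrightarrow> norm (F x - F y) \<le> \<Lambda> * norm (x - y)"
    and U: "mild F U0 f U" and V: "mild F U0 f V" and t: "t \<ge> 0"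
  shows "U t = V t"
proof -
  have cont: "continuous_on {0..} U" "continuous_on {0..} V"
    and eq: "\<And>t. t \<ge> 0 \<Longrightarrow> U t = duhamel F U0 f U t" "\<And>t. t \<ge> 0 \<Longrightarrow> V t = duhamel F U0 f V t"
    using U V mild_iff_duhamel[OF F f] by blast+
  have "bounded (U ` {0..t} \<union> V ` {0..t})"
    by (intro compact_imp_bounded compact_Un compact_continuous_image continuous_on_restrict0 cont compact_Icc)
  then obtain r where r: "r > 0" "\<And>s. s \<in> {0..t} \<Longrightarrow> norm (U s) \<le> r" "\<And>s. s \<in> {0..t} \<Longrightarrow> norm (V s) \<le> r"
    by (auto simp: bounded_pos)
  obtain \<Lambda> where \<Lambda>: "\<Lambda> \<ge> 0" "\<And>x y. norm x \<le> r \<Longrightarrow> norm y \<le> r \<Longrightarrow> norm (F x - F y) \<le> \<Lambda> * norm (x - y)"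
    using lip[OF r(1)] by blast
  define u where "u s = norm (U s - V s)" for s
  define \<kappa> where "\<kappa> s = M * \<beta> * \<bar>k s\<bar>" for s
  have u_cont: "continuous_on {0..} u" unfolding u_def by (intro continuous_intros cont)
  have "u t \<le> 0 * exp (integral {0..t} (\<lambda>s. \<kappa> (s + \<tau>)) + M * \<Lambda> * t)"
  proof (rule gronwall_delay[OF \<tau>_pos t])
    show "M * \<Lambda> \<ge> 0" using M_pos \<Lambda> by simp
    show "\<kappa> integrable_on {0..T}" for T
      unfolding \<kappa>_def using k_abs_int by (intro integrable_on_mult_right) (auto simp: absolutely_integrable_on_def)
    show "\<kappa> s \<ge> 0" for s using M_pos \<beta>_nonneg by (simp add: \<kappa>_def)
    show "continuous_on {0..t} u" by (rule continuous_on_restrict0[OF u_cont])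
    show "u s \<ge> 0" for s by (simp add: u_def)
    fix x assume x: "x \<in> {0..t}"
    have "u x = norm (duhamel F U0 f U x - duhamel F U0 f V x)"
      using eq[of x] x by (simp add: u_def)
    also have "\<dots> \<le> integral {0..x} (\<lambda>s. \<bar>k2 s\<bar> * (M * (\<beta> * norm (delayed U s - delayed V s))))
        + integral {0..x} (\<lambda>s. M * (\<Lambda> * u s))"
    proof (rule duhamel_diff_bound[OF F cont])
      show "norm (F (U s) - F (V s)) \<le> \<Lambda> * u s" if "s \<in> {0..x}" for s
        unfolding u_def using that x by (intro \<Lambda> r) auto
      show "continuous_on {0..x} (\<lambda>s. \<Lambda> * u s)"
        by (intro continuous_intros continuous_on_restrict0 u_cont)
      show "continuous_on {0..x} (\<lambda>s. norm (delayed U s - delayed V s))"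
        by (intro continuous_intros continuous_on_restrict0 delayed_continuous cont)
    qed simp
    also have "integral {0..x} (\<lambda>s. \<bar>k2 s\<bar> * (M * (\<beta> * norm (delayed U s - delayed V s))))
        = integral {0..x} (\<lambda>s. (if s \<le> \<tau> then 0 else \<kappa> s) * u (max 0 (s - \<tau>)))"
      by (intro integral_cong) (simp add: abs_k2 \<kappa>_def u_def delayed_def)
    also have "integral {0..x} (\<lambda>s. M * (\<Lambda> * u s)) = M * \<Lambda> * integral {0..x} u"
      by (simp flip: integral_mult_right add: mult.assoc)
    finally show "u x \<le> 0 + integral {0..x} (\<lambda>s. (if s \<le> \<tau> then 0 else \<kappa> s) * u (max 0 (s - \<tau>)))
        + M * \<Lambda> * integral {0..x} u" by simp
  qed simp
  then show ?thesis by (simp add: u_def)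
qed

end

section \<open>Truncation of the source and small data\<close>

definition radial_retraction :: "real \<Rightarrow> 'a::real_normed_vector \<Rightarrow> 'a" where
  "radial_retraction r x = (r / max r (norm x)) *\<^sub>R x"

lemma radial_retraction_id: "r > 0 \<Longrightarrow> norm x \<le> r \<Longrightarrow> radial_retraction r x = x"
  by (simp add: radial_retraction_def max_def)

lemma norm_radial_retraction:
  assumes "r > 0"
  shows "norm (radial_retraction r x) \<le> r" "norm (radial_retraction r x) \<le> norm x"
proof -
  have m: "max r (norm x) > 0" using assms by simp
  have eq: "norm (radial_retraction r x) = r * norm x / max r (norm x)"
    using assms m by (simp add: radial_retraction_def abs_of_pos)
  have "r * norm x \<le> r * max r (norm x)" "r * norm x \<le> max r (norm x) * norm x"
    using assms by (auto intro: mult_left_mono mult_right_mono)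
  then show "norm (radial_retraction r x) \<le> r" "norm (radial_retraction r x) \<le> norm x"
    unfolding eq using m by (simp_all add: pos_divide_le_eq mult.commute)
qed

text \<open>The constant 2 is valid in every normed space. It enters the existence proof, where any
  constant will do, and not the decay rate.\<close>

lemma radial_retraction_lipschitz:
  assumes r: "r > 0"
  shows "norm (radial_retraction r x - radial_retraction r y) \<le> 2 * norm (x - y)"
proof -
  define p q where "p = max r (norm x)" and "q = max r (norm y)"
  have pq: "p > 0" "q > 0" "r \<le> p" "norm y \<le> q" using r by (auto simp: p_def q_def)
  have "\<bar>q - p\<bar> \<le> \<bar>norm y - norm x\<bar>" by (auto simp: p_def q_def)
  also have "\<dots> \<le> norm (x - y)" using norm_triangle_ineq3[of y x] by (simp add: norm_minus_commute)
  finally have qp: "\<bar>q - p\<bar> \<le> norm (x - y)" .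
  \<comment> \<open>Written in this way the coefficient of \<open>y\<close> splits into
    \<open>q - p\<close>, which is controlled by \<open>x - y\<close>, and the factors
    \<open>r / p\<close> and \<open>norm y / q\<close>, both at most 1.\<close>
  have coefficient: "(q - p) * (r / p) / q = r / p - r / q" using pq by (simp add: field_simps)
  have "radial_retraction r x - radial_retraction r y = (r / p) *\<^sub>R (x - y) + ((q - p) * (r / p) / q) *\<^sub>R y"
    unfolding coefficient radial_retraction_def p_def[symmetric] q_def[symmetric]
    by (simp add: scaleR_diff_right scaleR_diff_left)
  also have "norm \<dots> \<le> norm ((r / p) *\<^sub>R (x - y)) + norm (((q - p) * (r / p) / q) *\<^sub>R y)"
    by (rule norm_triangle_ineq)
  also have "norm ((r / p) *\<^sub>R (x - y)) \<le> 1 * norm (x - y)"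
    unfolding norm_scaleR using pq r by (intro mult_right_mono) auto
  also have "norm (((q - p) * (r / p) / q) *\<^sub>R y) = \<bar>q - p\<bar> * (r / p) * (norm y / q)"
    using pq r by (simp add: abs_mult)
  also have "\<dots> \<le> norm (x - y) * 1 * 1"
    using pq r qp by (intro mult_mono) auto
  finally show ?thesis by simp
qed

context semilinear_delay
begin

text \<open>Since \<open>F\<close> vanishes at \<open>0\<close>, composing it with the retraction onto the ball of radius \<open>r\<close> keeps
  the linear bound used in the decay estimate. For small data that estimate keeps the global
  solution of the retracted equation inside the ball, where both equations agree.\<close>

theorem small_data_well_posed_and_decay:
  fixes F :: "'a \<Rightarrow> 'a" and L :: "real \<Rightarrow> real"
  assumes F0: "F 0 = 0"
    and L_pos: "\<And>r. r > 0 \<Longrightarrow> L r > 0"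
    and F_lip: "\<And>r x y. r > 0 \<Longrightarrow> norm x \<le> r \<Longrightarrow> norm y \<le> r \<Longrightarrow> norm (F x - F y) \<le> L r * norm (x - y)"
    and K: "integral {0..\<tau>} (\<lambda>s. \<bar>k s\<bar>) \<le> K"
    and \<gamma>: "\<gamma> \<ge> 0"
    and growth: "\<And>t. t > 0 \<Longrightarrow> M * \<beta> * exp (\<omega> * \<tau>) * integral {0..t} (\<lambda>s. \<bar>k (s + \<tau>)\<bar>) \<le> \<gamma> + \<omega>' * t"
    and r: "r > 0" and Lr: "L r < (\<omega> - \<omega>') / M"
  obtains \<rho> where "\<rho> > 0"
    "\<And>U0 f. continuous_on {- \<tau>..0} f \<Longrightarrow>
      (norm U0)\<^sup>2 + integral {0..\<tau>} (\<lambda>s. \<bar>k s\<bar> * (norm (f (s - \<tau>)))\<^sup>2) < \<rho>\<^sup>2 \<Longrightarrow>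
      \<exists>U. mild F U0 f U \<and> (\<forall>t\<ge>0. norm (U t) \<le> r) \<and>
        (\<forall>V. mild F U0 f V \<longrightarrow> (\<forall>t\<ge>0. V t = U t)) \<and>
        (\<forall>t\<ge>0. norm (U t) \<le> M * exp \<gamma>
          * (norm U0 + integral {0..\<tau>} (\<lambda>s. exp (\<omega> * s) * \<bar>k s\<bar> * norm (f (s - \<tau>))))
          * exp (- (\<omega> - \<omega>' - M * L r) * t))"
proof -
  have K_nonneg: "K \<ge> 0"
    using K k_abs_int[of \<tau>] by (intro order_trans[OF integral_nonneg K]) (auto simp: absolutely_integrable_on_def)
  \<comment> \<open>\<open>E\<close> is the ratio by which the data term of the decay estimate can
    exceed \<open>\<rho>\<close>: 1 for the initial value, the rest for the history.
    \<open>\<rho>\<close> is then chosen so that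
    \<open>M * exp \<gamma> * (\<rho> * E) = r\<close>.\<close>
  define E where "E = 1 + exp (\<omega> * \<tau>) * (K + 1)"
  define \<rho> where "\<rho> = r / (M * exp \<gamma> * E)"
  have E: "E > 0" using K_nonneg by (simp add: E_def add_pos_nonneg)
  have \<rho>: "\<rho> > 0" using r M_pos E by (simp add: \<rho>_def)
  have F_cont: "continuous_on UNIV F"
  proof (rule continuous_at_imp_continuous_on, intro ballI)
    fix x :: 'a
    define R where "R = norm x + 1"
    have R: "R > 0" by (simp add: R_def add_nonneg_pos)
    have "(L R)-lipschitz_on (ball 0 R) F"
      using L_pos[OF R] F_lip[OF R] by (intro lipschitz_onI) (auto simp: dist_norm)
    then have "continuous_on (ball 0 R) F" by (rule lipschitz_on_continuous_on)
    moreover have "x \<in> ball 0 R" by (simp add: R_def)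
    ultimately show "isCont F x" using continuous_on_eq_continuous_at[OF open_ball] by blast
  qed
  define G where "G x = F (radial_retraction r x)" for x
  have G_lip: "norm (G x - G y) \<le> (2 * L r) * norm (x - y)" for x y
  proof -
    have "norm (G x - G y) \<le> L r * norm (radial_retraction r x - radial_retraction r y)"
      unfolding G_def by (intro F_lip r norm_radial_retraction)
    also have "\<dots> \<le> L r * (2 * norm (x - y))"
      using L_pos[OF r] by (intro mult_left_mono radial_retraction_lipschitz r) auto
    finally show ?thesis by simp
  qed
  have G0: "G 0 = 0" using F0 by (simp add: G_def radial_retraction_def)
  \<comment> \<open>Comparison with 0 costs only \<open>L r\<close>, not \<open>2 * L r\<close>,
    since the retraction does not increase norms. This keeps the decay rate as claimed.\<close>
  have G_bound: "norm (G x) \<le> L r * norm x" for x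
  proof -
    have "norm (F (radial_retraction r x) - F 0) \<le> L r * norm (radial_retraction r x - 0)"
      using r by (intro F_lip norm_radial_retraction) auto
    also have "\<dots> \<le> L r * norm x"
      using L_pos[OF r] norm_radial_retraction(2)[OF r, of x] by (simp add: mult_left_mono)
    finally show ?thesis by (simp add: G_def F0)
  qed
  have G_cont: "continuous_on UNIV G"
    using G_lip L_pos[OF r] by (intro lipschitz_on_continuous_on[of "2 * L r"] lipschitz_onI) (auto simp: dist_norm)
  have "\<exists>U. mild F U0 f U \<and> (\<forall>t\<ge>0. norm (U t) \<le> r) \<and>
        (\<forall>V. mild F U0 f V \<longrightarrow> (\<forall>t\<ge>0. V t = U t)) \<and>
        (\<forall>t\<ge>0. norm (U t) \<le> M * exp \<gamma>
          * (norm U0 + integral {0..\<tau>} (\<lambda>s. exp (\<omega> * s) * \<bar>k s\<bar> * norm (f (s - \<tau>))))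
          * exp (- (\<omega> - \<omega>' - M * L r) * t))"
    if f: "continuous_on {- \<tau>..0} f"
      and small: "(norm U0)\<^sup>2 + integral {0..\<tau>} (\<lambda>s. \<bar>k s\<bar> * (norm (f (s - \<tau>)))\<^sup>2) < \<rho>\<^sup>2" for U0 f
  proof -
    define D where "D = norm U0 + integral {0..\<tau>} (\<lambda>s. exp (\<omega> * s) * \<bar>k s\<bar> * norm (f (s - \<tau>)))"
    define J where "J = integral {0..\<tau>} (\<lambda>s. \<bar>k s\<bar> * (norm (f (s - \<tau>)))\<^sup>2)"
    have f_cont: "continuous_on {0..\<tau>} (\<lambda>s. f (s - \<tau>))"
      by (rule continuous_on_compose2[OF f]) (auto intro!: continuous_intros)
    have J_int: "(\<lambda>s. \<bar>k s\<bar> * (norm (f (s - \<tau>)))\<^sup>2) integrable_on {0..\<tau>}"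
      using integrable_kernel_continuous[OF k_abs_int, of \<tau> "\<lambda>s. (norm (f (s - \<tau>)))\<^sup>2"] f_cont
      by (simp add: continuous_intros)
    have J: "J \<ge> 0" unfolding J_def by (intro integral_nonneg J_int) simp
    have k_ab: "(\<lambda>s. \<bar>k s\<bar>) integrable_on {0..\<tau>}"
      using k_abs_int[of \<tau>] by (auto simp: absolutely_integrable_on_def)
    have J_lt: "J < \<rho>\<^sup>2" "(norm U0)\<^sup>2 < \<rho>\<^sup>2" using small J zero_le_power2[of "norm U0"] unfolding J_def by linarith+
    have U0: "norm U0 < \<rho>" using J_lt(2) \<rho> by (simp add: power2_less_imp_less)
    have "integral {0..\<tau>} (\<lambda>s. exp (\<omega> * s) * \<bar>k s\<bar> * norm (f (s - \<tau>)))
        \<le> integral {0..\<tau>} (\<lambda>s. exp (\<omega> * \<tau>) * (\<rho> * \<bar>k s\<bar> + (1 / \<rho>) * (\<bar>k s\<bar> * (norm (f (s - \<tau>)))\<^sup>2)))"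
    proof (rule integral_le)
      show "(\<lambda>s. exp (\<omega> * s) * \<bar>k s\<bar> * norm (f (s - \<tau>))) integrable_on {0..\<tau>}"
        using integrable_kernel_continuous[OF k_abs_int, of \<tau> "\<lambda>s. exp (\<omega> * s) * norm (f (s - \<tau>))"] f_cont
        by (simp add: continuous_intros mult_ac)
      show "(\<lambda>s. exp (\<omega> * \<tau>) * (\<rho> * \<bar>k s\<bar> + (1 / \<rho>) * (\<bar>k s\<bar> * (norm (f (s - \<tau>)))\<^sup>2))) integrable_on {0..\<tau>}"
        by (intro integrable_on_mult_right integrable_add k_ab J_int)
      fix s assume s: "s \<in> {0..\<tau>}"
      define z where "z = norm (f (s - \<tau>))"
      \<comment> \<open>Replaces Cauchy-Schwarz: it passes from the quadratic smallness of the
        history to its linear integral, with a loss proportional to \<open>\<rho>\<close>.\<close>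
      have "z \<le> \<rho> + (1 / \<rho>) * z\<^sup>2"
      proof (cases "z \<le> \<rho>")
        case True
        then show ?thesis using \<rho> by (simp add: add_increasing2)
      next
        case False
        then have "\<rho> * z \<le> z\<^sup>2" unfolding power2_eq_square using \<rho> by (intro mult_right_mono) auto
        then have "z \<le> (1 / \<rho>) * z\<^sup>2" using \<rho> by (simp add: pos_le_divide_eq mult.commute)
        then show ?thesis using \<rho> by simp
      qed
      then have kz: "\<bar>k s\<bar> * z \<le> \<bar>k s\<bar> * (\<rho> + (1 / \<rho>) * z\<^sup>2)" by (intro mult_left_mono) auto
      have ee: "exp (\<omega> * s) \<le> exp (\<omega> * \<tau>)" using s \<omega>_nonneg by (simp add: mult_left_mono)
      have "exp (\<omega> * s) * (\<bar>k s\<bar> * z) \<le> exp (\<omega> * \<tau>) * (\<bar>k s\<bar> * (\<rho> + (1 / \<rho>) * z\<^sup>2))"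
        by (rule mult_mono[OF ee kz]) (auto simp: z_def)
      then show "exp (\<omega> * s) * \<bar>k s\<bar> * norm (f (s - \<tau>))
          \<le> exp (\<omega> * \<tau>) * (\<rho> * \<bar>k s\<bar> + (1 / \<rho>) * (\<bar>k s\<bar> * (norm (f (s - \<tau>)))\<^sup>2))"
        by (simp add: z_def algebra_simps)
    qed
    also have "\<dots> = exp (\<omega> * \<tau>) * (\<rho> * integral {0..\<tau>} (\<lambda>s. \<bar>k s\<bar>) + (1 / \<rho>) * J)"
      unfolding J_def using integral_add[OF integrable_on_mult_right[OF k_ab, of \<rho>] integrable_on_mult_right[OF J_int, of "1 / \<rho>"]]
      by simp
    also have "\<dots> \<le> exp (\<omega> * \<tau>) * (\<rho> * K + (1 / \<rho>) * \<rho>\<^sup>2)"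
      using \<rho> K J_lt by (intro mult_left_mono add_mono) auto
    also have "\<dots> = \<rho> * (exp (\<omega> * \<tau>) * (K + 1))" using \<rho> by (simp add: power2_eq_square algebra_simps)
    finally have D_le: "D \<le> \<rho> * E" using U0 unfolding D_def E_def distrib_left[of \<rho>] by simp
    have "M * exp \<gamma> * D \<le> M * exp \<gamma> * (\<rho> * E)" using M_pos by (intro mult_left_mono D_le) auto
    also have "\<dots> = r" using M_pos E by (simp add: \<rho>_def)
    finally have MD: "M * exp \<gamma> * D \<le> r" .
    obtain U where U: "mild G U0 f U"
      using mild_solution_exists[OF G_lip G0 _ f] L_pos[OF r] by auto
    have decay: "norm (U t) \<le> M * exp \<gamma> * D * exp (- (\<omega> - \<omega>' - M * L r) * t)" if "t \<ge> 0" for t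
      unfolding D_def
      using mild_solution_decay[OF G_cont f U less_imp_le[OF L_pos[OF r]] G_bound \<gamma> growth that] by simp
    \<comment> \<open>The smallness of \<open>L r\<close> makes the rate positive, so the decay
      bound never exceeds its value at time 0, which is at most \<open>r\<close> by the choice of
      \<open>\<rho>\<close>.\<close>
    have bound: "norm (U t) \<le> r" if t: "t \<ge> 0" for t
    proof -
      have "\<omega> - \<omega>' - M * L r > 0" using Lr M_pos by (simp add: pos_less_divide_eq mult.commute)
      then have "(\<omega> - \<omega>' - M * L r) * t \<ge> 0" using t by (intro mult_nonneg_nonneg) auto
      then have "exp (- (\<omega> - \<omega>' - M * L r) * t) \<le> 1"
        by (simp only: exp_le_one_iff mult_minus_left neg_le_0_iff_le)
      moreover have "M * exp \<gamma> * D * 1 \<ge> 0"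
      proof -
        have "norm (U 0) \<le> M * exp \<gamma> * D" using decay[of 0] by simp
        then show ?thesis using norm_ge_zero[of "U 0"] by linarith
      qed
      ultimately have "M * exp \<gamma> * D * exp (- (\<omega> - \<omega>' - M * L r) * t) \<le> M * exp \<gamma> * D * 1"
        by (intro mult_left_mono) auto
      then show ?thesis using decay[OF t] MD by linarith
    qed
    \<comment> \<open>The solution never leaves the ball on which the retraction is the identity, so
      the two integrands coincide along it.\<close>
    have "mild F U0 f U"
      using U unfolding mild_def
    proof (elim conjE, intro conjI allI impI)
      fix t :: real assume t: "t \<ge> 0"
      assume *: "\<forall>t\<ge>0. ((\<lambda>s. T (t - s) (- k s *\<^sub>R (if s \<le> \<tau> then f (s - \<tau>) else BB (U (s - \<tau>))) + G (U s)))
        has_integral U t - T t U0) {0..t}"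
      show "((\<lambda>s. T (t - s) (- k s *\<^sub>R (if s \<le> \<tau> then f (s - \<tau>) else BB (U (s - \<tau>))) + F (U s)))
        has_integral U t - T t U0) {0..t}"
        by (rule has_integral_eq[OF _ *[rule_format, OF t]])
          (simp add: G_def radial_retraction_id r bound)
    qed
    \<comment> \<open>Uniqueness is applied to \<open>F\<close> rather than \<open>G\<close>,
      because a competitor \<open>V\<close> is not known to stay in the ball.\<close>
    moreover have "V t = U t" if "mild F U0 f V" "t \<ge> 0" for V t
    proof (rule mild_solution_unique[OF F_cont f _ that(1) \<open>mild F U0 f U\<close> that(2)])
      show "\<exists>\<Lambda>\<ge>0. \<forall>x y. norm x \<le> R \<longrightarrow> norm y \<le> R \<longrightarrow> norm (F x - F y) \<le> \<Lambda> * norm (x - y)" if "R > 0" for R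
        using F_lip[OF that] L_pos[OF that] by (intro exI[of _ "L R"]) auto
    qed
    ultimately show ?thesis using bound decay unfolding D_def by blast
  qed
  with \<rho> show thesis by (rule that)
qed

end

section \<open>The energy space as a Banach space type\<close>

text \<open>A type of sort \<open>{real_inner, complete_space}\<close> is not known to be of class \<open>banach\<close>, whereas
  its dual \<open>'a \<Rightarrow>\<^sub>L real\<close> is; the Riesz isometry identifies the two.\<close>

lemma norm_blinfun_inner_left:
  "norm (blinfun_inner_left x) = norm (x :: 'a::real_inner)"
proof (rule antisym)
  show "norm (blinfun_inner_left x) \<le> norm x"
    by (rule norm_blinfun_bound) (auto simp: Cauchy_Schwarz_ineq2 mult.commute[of "norm x"])
  have "norm x * norm x \<le> norm (blinfun_inner_left x) * norm x"
    using norm_blinfun[of "blinfun_inner_left x" x]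
    by (simp add: power2_norm_eq_inner[symmetric] power2_eq_square)
  then show "norm x \<le> norm (blinfun_inner_left x)"
    by (cases "x = 0") auto
qed

lemma bij_blinfun_inner_left:
  "bij (blinfun_inner_left :: 'a::{real_inner,complete_space} \<Rightarrow> 'a \<Rightarrow>\<^sub>L real)"
proof (rule bijI)
  interpret bounded_linear "blinfun_inner_left :: 'a \<Rightarrow> 'a \<Rightarrow>\<^sub>L real"
    by (rule bounded_linear_blinfun_inner_left)
  show "inj (blinfun_inner_left :: 'a \<Rightarrow> 'a \<Rightarrow>\<^sub>L real)"
  proof (rule injI)
    fix x y :: 'a
    assume "blinfun_inner_left x = blinfun_inner_left y"
    then have "norm (x - y) = 0" by (simp add: norm_blinfun_inner_left[symmetric] diff)
    then show "x = y" by simp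
  qed
  show "surj (blinfun_inner_left :: 'a \<Rightarrow> 'a \<Rightarrow>\<^sub>L real)"
    unfolding surj_def
  proof
    fix l :: "'a \<Rightarrow>\<^sub>L real"
    obtain g where "\<And>x. blinfun_apply l x = x \<bullet> g"
      using riesz_representation[OF blinfun.bounded_linear_right[of l]] by blast
    then have "l = blinfun_inner_left g" by (intro blinfun_eqI) simp
    then show "\<exists>g. l = blinfun_inner_left g" ..
  qed
qed

lemma bounded_linear_inv_blinfun_inner_left:
  "bounded_linear (inv (blinfun_inner_left :: 'a::{real_inner,complete_space} \<Rightarrow> 'a \<Rightarrow>\<^sub>L real))"
proof -
  let ?i = "blinfun_inner_left :: 'a \<Rightarrow> 'a \<Rightarrow>\<^sub>L real"
  interpret i: bounded_linear ?i by (rule bounded_linear_blinfun_inner_left)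
  have i_inv: "?i (inv ?i l) = l" for l by (rule surj_f_inv_f[OF bij_is_surj[OF bij_blinfun_inner_left]])
  have inv_i: "inv ?i (?i x) = x" for x by (rule inv_f_f[OF bij_is_inj[OF bij_blinfun_inner_left]])
  show ?thesis
  proof (rule bounded_linear_intro[of _ 1])
    show "inv ?i (l + l') = inv ?i l + inv ?i l'" for l l'
      using inv_i[of "inv ?i l + inv ?i l'"] by (simp add: i.add i_inv)
    show "inv ?i (c *\<^sub>R l) = c *\<^sub>R inv ?i l" for c l
      using inv_i[of "c *\<^sub>R inv ?i l"] by (simp add: i.scaleR i_inv)
    show "norm (inv ?i l) \<le> norm l * 1" for l
      using norm_blinfun_inner_left[of "inv ?i l"] by (simp add: i_inv)
  qed
qed

text \<open>The Riesz map and its inverse are both bounded and linear, so integrals pass through in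
  either direction.\<close>

lemma has_integral_blinfun_inner_left_iff:
  fixes g :: "real \<Rightarrow> 'a::{real_inner,complete_space}"
  shows "((\<lambda>s. blinfun_inner_left (g s)) has_integral blinfun_inner_left y) S \<longleftrightarrow> (g has_integral y) S"
proof
  let ?i = "blinfun_inner_left :: 'a \<Rightarrow> 'a \<Rightarrow>\<^sub>L real"
  have inv_i: "inv ?i (?i x) = x" for x by (rule inv_f_f[OF bij_is_inj[OF bij_blinfun_inner_left]])
  assume "((\<lambda>s. ?i (g s)) has_integral ?i y) S"
  from has_integral_linear[OF this bounded_linear_inv_blinfun_inner_left]
  show "(g has_integral y) S" by (simp add: inv_i o_def)
next
  assume "(g has_integral y) S"
  from has_integral_linear[OF this bounded_linear_blinfun_inner_left]
  show "((\<lambda>s. blinfun_inner_left (g s)) has_integral blinfun_inner_left y) S" by (simp add: o_def)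
qed

text \<open>A zero of \<open>R\<close> lies in \<open>DA\<close> and is a zero of \<open>A\<close>;
  conversely every value of \<open>A\<close> is a value of \<open>R\<close>, as
  \<open>A x = R (R x)\<close>. Surjectivity puts the energy space in isometric correspondence with
  a complete product.\<close>

lemma sqrt_op_bij:
  assumes "positive_sqrt_op DA A DR R" "has_compact_inverse DA A"
  shows "linear_map_on DR R" "bij_betw R DR UNIV"
proof -
  show lin: "linear_map_on DR R"
    using assms by (simp add: positive_sqrt_op_def positive_self_adjoint_def self_adjoint_op_def)
  have DA: "DA = {x \<in> DR. R x \<in> DR}" and RR: "\<And>x. x \<in> DA \<Longrightarrow> R (R x) = A x"
    and A: "bij_betw A DA UNIV"
    using assms by (auto simp: positive_sqrt_op_def has_compact_inverse_def)
  have sub: "subspace DR" using lin by (simp add: linear_map_on_def)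
  then have zero: "0 \<in> DR" by (rule subspace_0)
  have scale: "R (c *\<^sub>R x) = c *\<^sub>R R x" if "x \<in> DR" for c x
    using lin that by (simp add: linear_map_on_def)
  have R0: "R 0 = 0" using scale[OF zero, of 0] by simp
  have inj: "x = 0" if "x \<in> DR" "R x = 0" for x
  proof -
    have "x \<in> DA" "0 \<in> DA" using that zero R0 by (auto simp: DA)
    moreover have "A x = A 0" using RR[OF \<open>x \<in> DA\<close>] RR[OF \<open>0 \<in> DA\<close>] that R0 by simp
    ultimately show ?thesis using A by (auto simp: bij_betw_def inj_on_def)
  qed
  show "bij_betw R DR UNIV"
    unfolding bij_betw_def
  proof
    show "inj_on R DR"
    proof (rule inj_onI)
      fix x y assume xy: "x \<in> DR" "y \<in> DR" "R x = R y"
      have "R (x + (-1) *\<^sub>R y) = R x + (-1) *\<^sub>R R y"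
        using lin xy(1) subspace_scale[OF sub xy(2)] scale[OF xy(2)] by (simp only: linear_map_on_def)
      then have "R (x - y) = 0" using xy by simp
      then have "x - y = 0" using inj[of "x - y"] xy sub by (simp add: subspace_diff)
      then show "x = y" by simp
    qed
    have "y \<in> R ` DR" for y
    proof -
      have "y \<in> A ` DA" using bij_betw_imp_surj_on[OF A] by simp
      then obtain x where x: "x \<in> DA" "A x = y" by blast
      then have "R x \<in> DR" "R (R x) = y" using RR[OF x(1)] by (auto simp: DA)
      then show ?thesis by blast
    qed
    then show "R ` DR = UNIV" by blast
  qed
qed

section \<open>Transport of the evolution equation along the isometry\<close>

locale energy_isometry =
  fixes DR :: "'h::{real_inner,complete_space} set" and R :: "'h \<Rightarrow> 'h"
  assumes R_linear: "linear_map_on DR R" and R_bij: "bij_betw R DR UNIV"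
begin

abbreviation E :: "('h \<times> 'h) set" where "E \<equiv> energy_space DR"

text \<open>The isometry \<open>(u, v) \<mapsto> (R u, v)\<close> followed by the Riesz map into the
  dual. It is linear and injective only on \<open>E\<close>, hence the restricted inverse
  below.\<close>

definition J :: "'h \<times> 'h \<Rightarrow> ('h \<times> 'h) \<Rightarrow>\<^sub>L real" where
  "J X = blinfun_inner_left (R (fst X), snd X)"

definition J_inv :: "('h \<times> 'h) \<Rightarrow>\<^sub>L real \<Rightarrow> 'h \<times> 'h" where "J_inv = inv_into E J"

lemma DR_subspace: "subspace DR"
  and R_add: "u \<in> DR \<Longrightarrow> v \<in> DR \<Longrightarrow> R (u + v) = R u + R v"
  and R_scale: "u \<in> DR \<Longrightarrow> R (c *\<^sub>R u) = c *\<^sub>R R u"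
  using R_linear by (auto simp: linear_map_on_def)

lemma R_zero: "R 0 = 0"
  using R_scale[OF subspace_0[OF DR_subspace], of 0] by simp

lemma R_diff: "u \<in> DR \<Longrightarrow> v \<in> DR \<Longrightarrow> R (u - v) = R u - R v"
  using R_add[of u "(-1) *\<^sub>R v"] R_scale[of v "-1"] subspace_scale[OF DR_subspace, of v "-1"] by simp

lemma E_subspace: "subspace E"
  unfolding energy_space_def by (intro subspace_Times DR_subspace subspace_UNIV)

lemma J_add: "X \<in> E \<Longrightarrow> Y \<in> E \<Longrightarrow> J (X + Y) = J X + J Y"
  and J_diff: "X \<in> E \<Longrightarrow> Y \<in> E \<Longrightarrow> J (X - Y) = J X - J Y"
  and J_scale: "X \<in> E \<Longrightarrow> J (c *\<^sub>R X) = c *\<^sub>R J X"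
proof -
  interpret i: bounded_linear "blinfun_inner_left :: 'h \<times> 'h \<Rightarrow> ('h \<times> 'h) \<Rightarrow>\<^sub>L real"
    by (rule bounded_linear_blinfun_inner_left)
  show "J (X + Y) = J X + J Y" "J (X - Y) = J X - J Y" if "X \<in> E" "Y \<in> E"
    using that unfolding J_def i.add[symmetric] i.diff[symmetric]
    by (simp_all only: energy_space_def mem_Times_iff fst_add snd_add fst_diff snd_diff R_add R_diff add_Pair diff_Pair)
  show "J (c *\<^sub>R X) = c *\<^sub>R J X" if "X \<in> E"
    using that unfolding J_def i.scaleR[symmetric]
    by (simp only: energy_space_def mem_Times_iff fst_scaleR snd_scaleR R_scale scaleR_Pair)
qed

lemma norm_J: "norm (J X) = energy_norm R X"
  by (simp add: J_def norm_blinfun_inner_left norm_prod_def energy_norm_def energy_inner_def power2_norm_eq_inner)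

lemma J_bij: "bij_betw J E UNIV"
proof -
  have "inj_on (map_prod R id) E" "map_prod R id ` E = UNIV \<times> UNIV"
    unfolding energy_space_def using R_bij
    by (simp_all add: bij_betw_def map_prod_inj_on map_prod_surj_on)
  then have "bij_betw (map_prod R id) E UNIV" by (simp add: bij_betw_def)
  from bij_betw_trans[OF this bij_blinfun_inner_left]
  show ?thesis by (simp add: J_def[abs_def] o_def map_prod_def case_prod_beta)
qed

lemma J_J_inv [simp]: "J (J_inv x) = x"
  unfolding J_inv_def by (rule bij_betw_inv_into_right[OF J_bij]) simp

lemma J_inv_in [simp]: "J_inv x \<in> E"
  unfolding J_inv_def using J_bij by (intro inv_into_into) (simp add: bij_betw_def)

lemma J_inv_J: "X \<in> E \<Longrightarrow> J_inv (J X) = X"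
  unfolding J_inv_def by (rule bij_betw_inv_into_left[OF J_bij])

lemma J_inv_add: "J_inv (x + y) = J_inv x + J_inv y"
  using J_inv_J[of "J_inv x + J_inv y"] by (simp add: J_add subspace_add[OF E_subspace])

lemma J_inv_scale: "J_inv (c *\<^sub>R x) = c *\<^sub>R J_inv x"
  using J_inv_J[of "c *\<^sub>R J_inv x"] by (simp add: J_scale subspace_scale[OF E_subspace])

lemma norm_J_inv: "energy_norm R (J_inv x) = norm x"
  using norm_J[of "J_inv x"] by simp

lemma linear_conjugate:
  assumes "linear_map_on E G" "G ` E \<subseteq> E"
  shows "linear (\<lambda>x. J (G (J_inv x)))"
proof (rule linearI)
  have G: "X \<in> E \<Longrightarrow> G X \<in> E" for X using assms(2) by blast
  show "J (G (J_inv (x + y))) = J (G (J_inv x)) + J (G (J_inv y))" for x y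
    using assms(1) by (simp add: J_inv_add linear_map_on_def J_add G)
  show "J (G (J_inv (c *\<^sub>R x))) = c *\<^sub>R J (G (J_inv x))" for c x
    using assms(1) by (simp add: J_inv_scale linear_map_on_def J_scale G)
qed

lemma has_energy_integral_iff:
  "has_energy_integral DR R G X I \<longleftrightarrow>
    (\<forall>s\<in>I. G s \<in> E) \<and> X \<in> E \<and> ((\<lambda>s. J (G s)) has_integral J X) I"
  unfolding has_energy_integral_def J_def has_integral_blinfun_inner_left_iff ..

lemma continuous_curve_iff:
  "continuous_curve E (energy_norm R) I U \<longleftrightarrow> (\<forall>t\<in>I. U t \<in> E) \<and> continuous_on I (\<lambda>t. J (U t))"
proof (cases "\<forall>t\<in>I. U t \<in> E")
  case True
  have "((\<lambda>s. energy_norm R (U s - U t)) \<longlongrightarrow> 0) (at t within I) \<longleftrightarrow> ((\<lambda>s. J (U s)) \<longlongrightarrow> J (U t)) (at t within I)"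
    if t: "t \<in> I" for t
  proof -
    have "((\<lambda>s. energy_norm R (U s - U t)) \<longlongrightarrow> 0) (at t within I)
        \<longleftrightarrow> ((\<lambda>s. norm (J (U s) - J (U t))) \<longlongrightarrow> 0) (at t within I)"
      by (rule tendsto_cong) (use True t in \<open>auto simp: eventually_at_filter norm_J[symmetric] J_diff\<close>)
    then show ?thesis by (simp add: tendsto_norm_zero_iff LIM_zero_iff)
  qed
  then show ?thesis using True by (auto simp: continuous_curve_def continuous_on_def)
qed (auto simp: continuous_curve_def)

text \<open>On \<open>E\<close> the map \<open>J\<close> commutes with all terms of Duhamel's
  formula, so the integrands agree once every term is known to lie in \<open>E\<close>. Membership
  of \<open>U t\<close> is kept as a separate conjunct because it cannot be read off from
  \<open>J (U t)\<close>.\<close>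

lemma mild_solution_iff:
  assumes D: "semilinear_delay (\<lambda>t x. J (S t (J_inv x))) M \<omega> \<tau> \<beta> (\<lambda>x. J (BB (J_inv x))) k"
    and S: "\<And>t X. t \<ge> 0 \<Longrightarrow> X \<in> E \<Longrightarrow> S t X \<in> E"
    and BB: "\<And>X. X \<in> E \<Longrightarrow> BB X \<in> E" and F: "\<And>X. X \<in> E \<Longrightarrow> F X \<in> E"
    and U0: "U0 \<in> E" and f: "\<And>t. t \<in> {- \<tau>..0} \<Longrightarrow> f t \<in> E"
  shows "mild_solution DR R S k \<tau> BB F U0 f U \<longleftrightarrow> (\<forall>t\<ge>0. U t \<in> E) \<and>
    semilinear_delay.mild (\<lambda>t x. J (S t (J_inv x))) \<tau> (\<lambda>x. J (BB (J_inv x))) k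
      (\<lambda>x. J (F (J_inv x))) (J U0) (\<lambda>t. J (f t)) (\<lambda>t. J (U t))"
proof (cases "\<forall>t\<ge>0. U t \<in> E")
  case U: True
  have "has_energy_integral DR R
          (\<lambda>s. S (t - s) (- k s *\<^sub>R (if s \<le> \<tau> then f (s - \<tau>) else BB (U (s - \<tau>))) + F (U s)))
          (U t - S t U0) {0..t} \<longleftrightarrow>
      ((\<lambda>s. J (S (t - s) (J_inv (- k s *\<^sub>R (if s \<le> \<tau> then J (f (s - \<tau>)) else J (BB (J_inv (J (U (s - \<tau>))))))
         + J (F (J_inv (J (U s)))))))) has_integral (J (U t) - J (S t (J_inv (J U0))))) {0..t}"
    (is "has_energy_integral DR R ?G _ _ \<longleftrightarrow> (?H has_integral _) _")
    if t: "t \<ge> 0" for t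
  proof -
    have GH: "?G s \<in> E \<and> J (?G s) = ?H s" if s: "s \<in> {0..t}" for s
    proof -
      define Y where "Y = (if s \<le> \<tau> then f (s - \<tau>) else BB (U (s - \<tau>)))"
      have Y: "Y \<in> E" using s U by (auto simp: Y_def intro!: f BB)
      have FU: "F (U s) \<in> E" using s U by (intro F) auto
      have X: "- k s *\<^sub>R Y + F (U s) \<in> E"
        using Y FU by (intro subspace_add[OF E_subspace] subspace_scale[OF E_subspace])
      have "J Y = (if s \<le> \<tau> then J (f (s - \<tau>)) else J (BB (J_inv (J (U (s - \<tau>))))))"
        using U s by (simp add: Y_def J_inv_J)
      moreover have "J (- k s *\<^sub>R Y + F (U s)) = - k s *\<^sub>R J Y + J (F (U s))"
        using Y FU subspace_scale[OF E_subspace Y, of "- k s"] by (simp only: J_add J_scale)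
      moreover have "J (F (U s)) = J (F (J_inv (J (U s))))" using U s by (simp add: J_inv_J)
      ultimately have "J_inv (- k s *\<^sub>R (if s \<le> \<tau> then J (f (s - \<tau>)) else J (BB (J_inv (J (U (s - \<tau>))))))
         + J (F (J_inv (J (U s))))) = - k s *\<^sub>R Y + F (U s)"
        using J_inv_J[OF X] by simp
      then show ?thesis using S[OF _ X, of "t - s"] s by (simp add: Y_def)
    qed
    have SU0: "S t U0 \<in> E" by (rule S[OF t U0])
    have Ut: "U t \<in> E" using U t by blast
    have "(?H has_integral J (U t - S t U0)) {0..t} \<longleftrightarrow> ((\<lambda>s. J (?G s)) has_integral J (U t - S t U0)) {0..t}"
      by (rule has_integral_cong) (use GH in simp)
    moreover have "J (U t - S t U0) = J (U t) - J (S t (J_inv (J U0)))"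
      using Ut SU0 U0 by (simp add: J_diff J_inv_J)
    ultimately show ?thesis
      unfolding has_energy_integral_iff using GH Ut SU0 subspace_diff[OF E_subspace] by auto
  qed
  then show ?thesis
    using U by (simp add: mild_solution_def semilinear_delay.mild_def[OF D] continuous_curve_iff)
next
  case False
  then show ?thesis by (auto simp: mild_solution_def continuous_curve_def)
qed

end

section \<open>The damped wave equation with delay\<close>

theorem theorem2p5:
  fixes A :: "'h::{real_inner,complete_space} \<Rightarrow> 'h" and DA :: "'h set"
    and R :: "'h \<Rightarrow> 'h" and DR :: "'h set"
    and C :: "'w1::{real_inner,complete_space} \<Rightarrow> 'h"
    and B :: "'w2::{real_inner,complete_space} \<Rightarrow> 'h"
    and \<tau> K :: real and k :: "real \<Rightarrow> real"
    and \<psi> :: "'h \<Rightarrow> real" and D\<psi> :: "'h \<Rightarrow> 'h \<Rightarrow> real" and grad\<psi> :: "'h \<Rightarrow> 'h"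
    and L h :: "real \<Rightarrow> real"
    and S :: "real \<Rightarrow> 'h \<times> 'h \<Rightarrow> 'h \<times> 'h"
    and M \<omega> \<gamma> \<omega>' :: real
  defines "grad\<psi> \<equiv> \<lambda>u. riesz_representative DR (D\<psi> u)"
  assumes A_op: "positive_self_adjoint DA A" "has_compact_inverse DA A"
    and A_sqrt: "positive_sqrt_op DA A DR R"
    and BC: "bounded_linear C" "bounded_linear B"
    and delay: "\<tau> > 0"
    and k_loc: "\<And>T. T > 0 \<Longrightarrow> k absolutely_integrable_on {0..T}"
    and k_bound: "K > 0" "\<And>t. t \<ge> 0 \<Longrightarrow> integral {max 0 (t - \<tau>)..t} (\<lambda>s. \<bar>k s\<bar>) \<le> K"
    and psi_deriv: "\<And>u. u \<in> DR \<Longrightarrow> gateaux_derivative DR (\<lambda>v. norm (R v)) \<psi> u (D\<psi> u)"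
    and H1: "\<And>u. u \<in> DR \<Longrightarrow> \<exists>c>0. \<forall>v\<in>DR. \<bar>D\<psi> u v\<bar> \<le> c * norm v"
    and H2: "\<And>r. r > 0 \<Longrightarrow> L r > 0"
      "\<And>r u v. r > 0 \<Longrightarrow> u \<in> DR \<Longrightarrow> v \<in> DR \<Longrightarrow> norm (R u) \<le> r \<Longrightarrow> norm (R v) \<le> r
         \<Longrightarrow> norm (grad\<psi> u - grad\<psi> v) \<le> L r * norm (R (u - v))"
    and H3: "\<psi> 0 = 0" "grad\<psi> 0 = 0"
      "continuous_on {0..} h" "strict_mono_on {0..} h"
      "\<And>u. u \<in> DR \<Longrightarrow> norm (grad\<psi> u) \<le> h (norm (R u)) * norm (R u)"
    and semigroup: "generates_C0_semigroup (energy_space DR) (energy_norm R)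
      (wave_domain DA DR) (wave_op A C) S"
    and exp_stable: "M > 0" "\<omega> > 0"
      "\<And>t X. t \<ge> 0 \<Longrightarrow> X \<in> energy_space DR
         \<Longrightarrow> energy_norm R (S t X) \<le> M * exp (- \<omega> * t) * energy_norm R X"
    and gamma: "\<gamma> \<ge> 0" and omega': "0 \<le> \<omega>'" "\<omega>' < \<omega>"
    and k_growth: "\<And>t. t > 0 \<Longrightarrow>
      M * (onorm B)\<^sup>2 * exp (\<omega> * \<tau>) * integral {0..t} (\<lambda>s. \<bar>k (s + \<tau>)\<bar>) \<le> \<gamma> + \<omega>' * t"
    and L_small: "\<exists>r>0. L r < (\<omega> - \<omega>') / M"
  shows "\<exists>\<rho>>0. \<exists>C\<rho>>0. L C\<rho> < (\<omega> - \<omega>') / M \<and>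
    (\<forall>U0\<in>energy_space DR. \<forall>f.
       continuous_curve (energy_space DR) (energy_norm R) {-\<tau>..0} f \<and>
       (energy_norm R U0)\<^sup>2 + integral {0..\<tau>} (\<lambda>s. \<bar>k s\<bar> * (energy_norm R (f (s - \<tau>)))\<^sup>2) < \<rho>\<^sup>2
       \<longrightarrow>
       (\<exists>U. mild_solution DR R S k \<tau> (delay_op B) (source_op grad\<psi>) U0 f U \<and>
            (\<forall>t>0. energy_norm R (U t) \<le> C\<rho>) \<and>
            (\<forall>V. mild_solution DR R S k \<tau> (delay_op B) (source_op grad\<psi>) U0 f V
                 \<longrightarrow> (\<forall>t\<ge>0. V t = U t))) \<and>
       (\<forall>U. mild_solution DR R S k \<tau> (delay_op B) (source_op grad\<psi>) U0 f U \<longrightarrow>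
            (\<forall>t\<ge>0. energy_norm R (U t)
               \<le> M * exp \<gamma> *
                 (energy_norm R U0
                   + integral {0..\<tau>} (\<lambda>s. exp (\<omega> * s) * \<bar>k s\<bar> * energy_norm R (f (s - \<tau>))))
                 * exp (- (\<omega> - \<omega>' - M * L C\<rho>) * t))))"
proof -
  interpret energy_isometry DR R
    by standard (rule sqrt_op_bij[OF A_sqrt A_op(2)])+
  have C0: "C0_semigroup E (energy_norm R) S" using semigroup by (simp add: generates_C0_semigroup_def)
  have S_in: "S t X \<in> E" if "t \<ge> 0" "X \<in> E" for t X
    using C0 that unfolding C0_semigroup_def by blast
  have S_linear: "linear_map_on E (S t)" "S t ` E \<subseteq> E" if "t \<ge> 0" for t
    using C0 that unfolding C0_semigroup_def by blast+
  have S_0: "S 0 X = X" if "X \<in> E" for X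
    using C0 that unfolding C0_semigroup_def by blast
  have S_add: "S (s + t) X = S s (S t X)" if "s \<ge> 0" "t \<ge> 0" "X \<in> E" for s t X
    using C0 that unfolding C0_semigroup_def by blast
  have S_lim: "((\<lambda>t. energy_norm R (S t X - X)) \<longlongrightarrow> 0) (at_right 0)" if "X \<in> E" for X
    using C0 that unfolding C0_semigroup_def by blast
  have zero_snd: "(0, v) \<in> E" for v using subspace_0[OF DR_subspace] by (simp add: energy_space_def)
  have norm_zero_snd: "energy_norm R (0, v) = norm v" for v
    by (simp add: energy_norm_def energy_inner_def R_zero flip: norm_eq_sqrt_inner)
  have snd_le: "norm (snd X) \<le> energy_norm R X" and fst_le: "norm (R (fst X)) \<le> energy_norm R X" for X
    unfolding energy_norm_def energy_inner_def norm_eq_sqrt_inner by (simp_all add: add_increasing add_increasing2)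
  have BB_in: "delay_op B X \<in> E" and F_in: "source_op grad\<psi> X \<in> E" for X
    by (simp_all add: delay_op_def source_op_def zero_snd)
  \<comment> \<open>The abstract setting asks for every real \<open>t\<close>, including degenerate
    intervals; \<open>max 1 t\<close> gives a positive length to which local integrability
    applies.\<close>
  have k_all: "k absolutely_integrable_on {0..t}" for t
    using k_loc[of "max 1 t"] by (rule absolutely_integrable_on_subinterval) auto
  have onorm_B: "onorm B \<ge> 0" by (rule onorm_pos_le[OF BC(2)])
  \<comment> \<open>Fixes the abstract constant \<open>\<beta>\<close> as
    \<open>(onorm B)\<^sup>2\<close>, the one occurring in the growth hypothesis on
    \<open>k\<close>.\<close>
  have BB_bound: "norm (J (delay_op B X)) \<le> (onorm B)\<^sup>2 * energy_norm R X" for X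
  proof -
    have "norm (J (delay_op B X)) = norm (B (adjoint B (snd X)))"
      by (simp add: norm_J delay_op_def norm_zero_snd)
    also have "\<dots> \<le> onorm B * norm (adjoint B (snd X))" by (rule onorm[OF BC(2)])
    also have "\<dots> \<le> onorm B * (onorm B * norm (snd X))"
      by (intro mult_left_mono norm_hilbert_adjoint_le BC onorm_B)
    also have "\<dots> \<le> onorm B * (onorm B * energy_norm R X)"
      by (intro mult_left_mono snd_le onorm_B)
    finally show ?thesis by (simp add: power2_eq_square mult.assoc)
  qed
  have BB_linear: "linear_map_on E (delay_op B)"
  proof -
    note lin = bounded_linear.linear[OF BC(2)] hilbert_adjoint_linear[OF BC(2)]
    show ?thesis
      by (simp add: linear_map_on_def E_subspace delay_op_def linear_add[OF lin(1)] linear_add[OF lin(2)]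
          linear_cmul[OF lin(1)] linear_cmul[OF lin(2)])
  qed
  interpret D: semilinear_delay "\<lambda>t x. J (S t (J_inv x))" M \<omega> \<tau> "(onorm B)\<^sup>2"
    "\<lambda>x. J (delay_op B (J_inv x))" k
  proof (rule semilinear_delay.intro)
    show "linear (\<lambda>x. J (S t (J_inv x)))" if "t \<ge> 0" for t
      by (rule linear_conjugate[OF S_linear[OF that]])
    show "J (S 0 (J_inv x)) = x" for x
      by (simp add: S_0)
    show "J (S (s + t) (J_inv x)) = J (S s (J_inv (J (S t (J_inv x)))))" if "s \<ge> 0" "t \<ge> 0" for s t x
      by (simp add: S_add[OF that] J_inv_J[OF S_in[OF that(2)]])
    show "((\<lambda>t. J (S t (J_inv x))) \<longlongrightarrow> x) (at_right 0)" for x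
    proof -
      have "((\<lambda>t. energy_norm R (S t (J_inv x) - J_inv x)) \<longlongrightarrow> 0) (at_right 0)"
        by (rule S_lim) simp
      moreover have "eventually (\<lambda>t. energy_norm R (S t (J_inv x) - J_inv x) = norm (J (S t (J_inv x)) - x)) (at_right 0)"
        unfolding eventually_at_filter
        by (intro always_eventually) (auto simp: norm_J[symmetric] J_diff S_in)
      ultimately have "((\<lambda>t. norm (J (S t (J_inv x)) - x)) \<longlongrightarrow> 0) (at_right 0)"
        by (rule Lim_transform_eventually)
      then show ?thesis by (simp add: tendsto_norm_zero_iff LIM_zero_iff)
    qed
    show "norm (J (S t (J_inv x))) \<le> M * exp (- \<omega> * t) * norm x" if "t \<ge> 0" for t x
      using exp_stable(3)[OF that J_inv_in, of x] by (simp add: norm_J norm_J_inv)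
    show "linear (\<lambda>x. J (delay_op B (J_inv x)))"
      by (rule linear_conjugate[OF BB_linear]) (use BB_in in blast)
    show "norm (J (delay_op B (J_inv x))) \<le> (onorm B)\<^sup>2 * norm x" for x
      using BB_bound[of "J_inv x"] by (simp add: norm_J_inv)
  qed (use exp_stable delay k_all in auto)
  \<comment> \<open>This radius will be \<open>C\<rho>\<close>; \<open>\<rho>\<close> is derived
    from it.\<close>
  obtain r where r: "r > 0" "L r < (\<omega> - \<omega>') / M" using L_small by blast
  let ?F = "\<lambda>x. J (source_op grad\<psi> (J_inv x))"
  have J_inv_0: "J_inv 0 = 0" using J_inv_scale[of 0 0] by simp
  have F_0: "?F 0 = 0"
    using H3(2) J_scale[OF zero_snd, of 0 0] by (simp add: J_inv_0 source_op_def zero_prod_def)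
  \<comment> \<open>The source reads only the first component and acts only on the second. Its
    increments thus have the plain norm of gradient increments, and the energy bound on a state
    restricts to its first component as H2 requires.\<close>
  have F_lip: "norm (?F x - ?F y) \<le> L s * norm (x - y)" if s: "s > 0" "norm x \<le> s" "norm y \<le> s" for s x y
  proof -
    define X Y where "X = J_inv x" and "Y = J_inv y"
    have XY: "fst X \<in> DR" "fst Y \<in> DR" "X \<in> E" "Y \<in> E"
      using J_inv_in unfolding X_def Y_def by (auto simp: energy_space_def mem_Times_iff)
    have nX: "norm (R (fst X)) \<le> s" "norm (R (fst Y)) \<le> s"
      using fst_le[of X] fst_le[of Y] s by (simp_all add: X_def Y_def norm_J_inv)
    have "?F x - ?F y = J (source_op grad\<psi> X - source_op grad\<psi> Y)"
      by (simp add: J_diff F_in X_def Y_def)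
    then have "norm (?F x - ?F y) = norm (grad\<psi> (fst X) - grad\<psi> (fst Y))"
      by (simp add: norm_J source_op_def norm_zero_snd)
    also have "\<dots> \<le> L s * norm (R (fst (X - Y)))"
      using H2(2)[OF s(1) XY(1,2) nX] by simp
    also have "\<dots> \<le> L s * energy_norm R (X - Y)"
      using H2(1)[OF s(1)] by (intro mult_left_mono fst_le) auto
    also have "energy_norm R (X - Y) = norm (x - y)"
      using XY by (simp add: norm_J[symmetric] J_diff) (simp add: X_def Y_def)
    finally show ?thesis .
  qed
  \<comment> \<open>At \<open>t = \<tau>\<close> the sliding window is exactly the interval on which
    the history acts.\<close>
  have k_\<tau>: "integral {0..\<tau>} (\<lambda>s. \<bar>k s\<bar>) \<le> K" using k_bound(2)[of \<tau>] delay by simp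
  obtain \<rho> where \<rho>: "\<rho> > 0" and main: "\<And>U0 f. continuous_on {- \<tau>..0} f \<Longrightarrow>
      (norm U0)\<^sup>2 + integral {0..\<tau>} (\<lambda>s. \<bar>k s\<bar> * (norm (f (s - \<tau>)))\<^sup>2) < \<rho>\<^sup>2 \<Longrightarrow>
      \<exists>U. D.mild ?F U0 f U \<and> (\<forall>t\<ge>0. norm (U t) \<le> r) \<and>
        (\<forall>V. D.mild ?F U0 f V \<longrightarrow> (\<forall>t\<ge>0. V t = U t)) \<and>
        (\<forall>t\<ge>0. norm (U t) \<le> M * exp \<gamma>
          * (norm U0 + integral {0..\<tau>} (\<lambda>s. exp (\<omega> * s) * \<bar>k s\<bar> * norm (f (s - \<tau>))))
          * exp (- (\<omega> - \<omega>' - M * L r) * t))"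
    using D.small_data_well_posed_and_decay[of ?F L, OF F_0 H2(1) F_lip k_\<tau> gamma k_growth r] by blast
  show ?thesis
  proof (rule exI[of _ \<rho>], rule conjI[OF \<rho>], rule exI[of _ r], rule conjI[OF r(1)], rule conjI[OF r(2)],
      rule ballI, rule allI, rule impI, elim conjE, rule conjI)
    fix U0 f
    assume U0: "U0 \<in> E" and f: "continuous_curve E (energy_norm R) {- \<tau>..0} f"
      and small: "(energy_norm R U0)\<^sup>2 + integral {0..\<tau>} (\<lambda>s. \<bar>k s\<bar> * (energy_norm R (f (s - \<tau>)))\<^sup>2) < \<rho>\<^sup>2"
    have f_in: "\<And>t. t \<in> {- \<tau>..0} \<Longrightarrow> f t \<in> E" and f_cont: "continuous_on {- \<tau>..0} (\<lambda>t. J (f t))"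
      using f by (auto simp: continuous_curve_iff)
    note iff = mild_solution_iff[OF D.semilinear_delay_axioms S_in BB_in F_in U0 f_in]
    obtain W where W: "D.mild ?F (J U0) (\<lambda>t. J (f t)) W" "\<And>t. t \<ge> 0 \<Longrightarrow> norm (W t) \<le> r"
      "\<And>V t. D.mild ?F (J U0) (\<lambda>t. J (f t)) V \<Longrightarrow> t \<ge> 0 \<Longrightarrow> V t = W t"
      "\<And>t. t \<ge> 0 \<Longrightarrow> norm (W t) \<le> M * exp \<gamma>
          * (energy_norm R U0 + integral {0..\<tau>} (\<lambda>s. exp (\<omega> * s) * \<bar>k s\<bar> * energy_norm R (f (s - \<tau>))))
          * exp (- (\<omega> - \<omega>' - M * L r) * t)"
      using main[OF f_cont, of "J U0"] small unfolding norm_J by blast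
    \<comment> \<open>Identifies an arbitrary solution with the constructed one, so that the decay
      bound for \<open>W\<close> carries over to every solution.\<close>
    have V_eq: "V t = J_inv (W t)"
      if "mild_solution DR R S k \<tau> (delay_op B) (source_op grad\<psi>) U0 f V" "t \<ge> 0" for V t
      using that W(3)[where V = "\<lambda>t. J (V t)" and t = t] iff[where U = V] J_inv_J[of "V t"] by auto
    have sol: "mild_solution DR R S k \<tau> (delay_op B) (source_op grad\<psi>) U0 f (\<lambda>t. J_inv (W t))"
      using iff W(1) by simp
    show "\<exists>U. mild_solution DR R S k \<tau> (delay_op B) (source_op grad\<psi>) U0 f U \<and>
        (\<forall>t>0. energy_norm R (U t) \<le> r) \<and>
        (\<forall>V. mild_solution DR R S k \<tau> (delay_op B) (source_op grad\<psi>) U0 f V \<longrightarrow> (\<forall>t\<ge>0. V t = U t))"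
      by (intro exI[of _ "\<lambda>t. J_inv (W t)"] conjI sol) (auto simp: norm_J_inv W(2) V_eq)
    show "\<forall>V. mild_solution DR R S k \<tau> (delay_op B) (source_op grad\<psi>) U0 f V \<longrightarrow>
        (\<forall>t\<ge>0. energy_norm R (V t) \<le> M * exp \<gamma>
          * (energy_norm R U0 + integral {0..\<tau>} (\<lambda>s. exp (\<omega> * s) * \<bar>k s\<bar> * energy_norm R (f (s - \<tau>))))
          * exp (- (\<omega> - \<omega>' - M * L r) * t))"
    proof (intro allI impI)
      fix V and t :: real
      assume V: "mild_solution DR R S k \<tau> (delay_op B) (source_op grad\<psi>) U0 f V" and t: "t \<ge> 0"
      show "energy_norm R (V t) \<le> M * exp \<gamma>
          * (energy_norm R U0 + integral {0..\<tau>} (\<lambda>s. exp (\<omega> * s) * \<bar>k s\<bar> * energy_norm R (f (s - \<tau>))))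
          * exp (- (\<omega> - \<omega>' - M * L r) * t)"
        unfolding V_eq[OF V t] norm_J_inv by (rule W(4)[OF t])
    qed
  qed
qed

end
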